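(* Let $n$ be a positive integer and let either $X=\mathbf{R}^n$ (with dual group $\Xi=\mathbf{R}^n$) or $X=\mathbf{T}^n$ (with dual group $\Xi=\mathbf{Z}^n$). Let $\mathcal{Y}$ be a closed linear subspace of $\overline{\mathcal{C}_0}(\Xi)$ such that $\mathcal{Y}$ is a subset of $[\mathcal{F}L^1](\Xi)$. If $\mathcal{Y}$ (with the supremum norm) is reflexive, then $\mathcal{Y}$ is of finite dimension.
   Context: Functions are complex-valued. $\mathbf{T}$ is the half-open interval $[-\pi,\pi[$, identified with the unit circle group; $\mathbf{R}^n$ and $\mathbf{T}^n$ carry Lebesgue measure. $\overline{\mathcal{C}_0}(\Xi)$ is the completion, under the norm $\|F\|=\sup_{\xi\in\Xi}|F(\xi)|$, of the space of continuous compactly supported functions on $\Xi$, i.e. the Banach space of continuous functions on $\Xi$ vanishing at infinity (for $\Xi=\mathbf{Z}^n$ this is the space of functions on $\mathbf{Z}^n$ tending to $0$ at infinity). For $f\in L^1(X)$ the Fourier transform is $[\mathcal{F}f](\xi)=\int_X e^{-ix\xi}f(x)\,dx$, $\xi\in\Xi$, where $x\xi$ denotes the scalar product; $\mathcal{F}$ is a bounded linear injective map $L^1(X)\to\overline{\mathcal{C}_0}(\Xi)$. $[\mathcal{F}L^1](\Xi)=\{\mathcal{F}f: f\in L^1(X)\}$ is its range. *)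

theory Defs
  imports "HOL-Analysis.Analysis" "HOL-Library.Function_Algebras"
begin

section \<open>Normed spaces of complex-valued functions\<close>

text \<open>Every normed space below is a set of complex-valued functions with the pointwise operations.
  This includes the duals: a functional on a space of functions of type \<open>'a \<Rightarrow> complex\<close> is itself a
  function of type \<open>('a \<Rightarrow> complex) \<Rightarrow> complex\<close>.\<close>

definition cscale :: "complex \<Rightarrow> ('a \<Rightarrow> complex) \<Rightarrow> 'a \<Rightarrow> complex" where
  "cscale c F = (\<lambda>x. c * F x)"

interpretation cfun: vector_space cscale
  by unfold_locales (auto simp: cscale_def fun_eq_iff algebra_simps)

definition finite_dim :: "('a \<Rightarrow> complex) set \<Rightarrow> bool" where
  "finite_dim V \<longleftrightarrow> (\<exists>B. finite B \<and> V = cfun.span B)"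

text \<open>A functional on \<open>V\<close> is normalised to be zero outside \<open>V\<close>, so that it is determined by its
  values on \<open>V\<close>.\<close>

definition dual :: "('a \<Rightarrow> complex) set \<Rightarrow> (('a \<Rightarrow> complex) \<Rightarrow> real) \<Rightarrow> (('a \<Rightarrow> complex) \<Rightarrow> complex) set"
  where "dual V N = {\<phi>.
     (\<forall>F\<in>V. \<forall>G\<in>V. \<phi> (F + G) = \<phi> F + \<phi> G) \<and>
     (\<forall>c. \<forall>F\<in>V. \<phi> (cscale c F) = c * \<phi> F) \<and>
     (\<exists>K. \<forall>F\<in>V. norm (\<phi> F) \<le> K * N F) \<and>
     (\<forall>F. F \<notin> V \<longrightarrow> \<phi> F = 0)}"

definition dual_norm :: "('a \<Rightarrow> complex) set \<Rightarrow> (('a \<Rightarrow> complex) \<Rightarrow> real) \<Rightarrow> (('a \<Rightarrow> complex) \<Rightarrow> complex) \<Rightarrow> real"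
  where "dual_norm V N \<phi> = (SUP F\<in>{F\<in>V. N F \<le> 1}. norm (\<phi> F))"

text \<open>Reflexivity: the canonical embedding into the bidual is onto.\<close>

definition reflexive :: "('a \<Rightarrow> complex) set \<Rightarrow> (('a \<Rightarrow> complex) \<Rightarrow> real) \<Rightarrow> bool" where
  "reflexive V N \<longleftrightarrow>
     (\<forall>\<Lambda>\<in>dual (dual V N) (dual_norm V N). \<exists>F\<in>V. \<forall>\<phi>\<in>dual V N. \<Lambda> \<phi> = \<phi> F)"


section \<open>Continuous functions vanishing at infinity\<close>

definition C0 :: "('a::topological_space \<Rightarrow> complex) set" where
  "C0 = {F. continuous_on UNIV F \<and> (\<forall>\<epsilon>>0. \<exists>K. compact K \<and> (\<forall>\<xi>. \<xi> \<notin> K \<longrightarrow> norm (F \<xi>) < \<epsilon>))}"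

definition sup_norm :: "('a \<Rightarrow> complex) \<Rightarrow> real" where
  "sup_norm F = (SUP \<xi>. norm (F \<xi>))"

text \<open>The value \<open>0\<close> outside \<open>C0\<close> is a dummy: \<open>Metric_space\<close> asks for nonnegativity of the distance
  everywhere, and the supremum of an unbounded set of reals is unspecified.\<close>

definition C0_dist :: "('a::topological_space \<Rightarrow> complex) \<Rightarrow> ('a \<Rightarrow> complex) \<Rightarrow> real" where
  "C0_dist F G = (if F \<in> C0 \<and> G \<in> C0 then sup_norm (F - G) else 0)"

lemma C0_bounded:
  assumes "F \<in> C0" shows "bdd_above (range (\<lambda>\<xi>. norm (F \<xi>)))"
proof -
  obtain K where K: "compact K" "\<And>\<xi>. \<xi> \<notin> K \<Longrightarrow> norm (F \<xi>) < 1"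
    using assms unfolding C0_def by (auto dest: spec[of _ 1])
  have "compact (F ` K)"
    using assms K(1) unfolding C0_def
    by (auto intro: compact_continuous_image continuous_on_subset)
  then obtain b where b: "\<And>\<xi>. \<xi> \<in> K \<Longrightarrow> norm (F \<xi>) \<le> b"
    by (meson bounded_iff compact_imp_bounded imageI)
  have "norm (F \<xi>) \<le> max b 1" for \<xi>
    using K(2)[of \<xi>] b[of \<xi>] by (cases "\<xi> \<in> K") auto
  then show ?thesis by (intro bdd_aboveI[of _ "max b 1"]) blast
qed

lemma C0_diff_bounded:
  assumes "F \<in> C0" "G \<in> C0" shows "bdd_above (range (\<lambda>\<xi>. norm ((F - G) \<xi>)))"
proof -
  obtain a b where "\<And>\<xi>. norm (F \<xi>) \<le> a" "\<And>\<xi>. norm (G \<xi>) \<le> b"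
    using C0_bounded[OF assms(1)] C0_bounded[OF assms(2)] unfolding bdd_above_def by auto
  then have "norm ((F - G) \<xi>) \<le> a + b" for \<xi>
    using norm_triangle_ineq4[of "F \<xi>" "G \<xi>"] by (smt (verit) minus_apply)
  then show ?thesis by (intro bdd_aboveI[of _ "a + b"]) blast
qed

interpretation C0: Metric_space C0 C0_dist
proof
  fix F G H :: "'a \<Rightarrow> complex"
  show "0 \<le> C0_dist F G"
    unfolding C0_dist_def sup_norm_def
    using cSUP_upper2[OF C0_diff_bounded UNIV_I norm_ge_zero, of F G] by auto
  show "C0_dist F G = C0_dist G F"
    unfolding C0_dist_def sup_norm_def by (auto simp: norm_minus_commute)
  show "(C0_dist F G = 0) = (F = G)" if FG: "F \<in> C0" "G \<in> C0"
  proof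
    assume "C0_dist F G = 0"
    then have "norm (F \<xi> - G \<xi>) \<le> 0" for \<xi>
      using cSUP_upper[OF UNIV_I C0_diff_bounded[OF FG], of \<xi>] FG
      by (simp add: C0_dist_def sup_norm_def)
    then show "F = G" by auto
  qed (simp add: C0_dist_def sup_norm_def)
  show "C0_dist F H \<le> C0_dist F G + C0_dist G H" if FGH: "F \<in> C0" "G \<in> C0" "H \<in> C0"
  proof -
    have "norm ((F - H) \<xi>) \<le> sup_norm (F - G) + sup_norm (G - H)" for \<xi>
      using cSUP_upper[OF UNIV_I C0_diff_bounded[OF FGH(1,2)], of \<xi>]
        cSUP_upper[OF UNIV_I C0_diff_bounded[OF FGH(2,3)], of \<xi>]
        norm_triangle_ineq[of "F \<xi> - G \<xi>" "G \<xi> - H \<xi>"]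
      by (simp add: sup_norm_def)
    then have "sup_norm (F - H) \<le> sup_norm (F - G) + sup_norm (G - H)"
      unfolding sup_norm_def[of "F - H"] by (intro cSUP_least) auto
    then show ?thesis using FGH by (simp add: C0_dist_def)
  qed
qed

text \<open>\<open>closedin\<close> includes the requirement \<open>Y \<subseteq> C0\<close>.\<close>

definition closed_subspace_C0 :: "('a::topological_space \<Rightarrow> complex) set \<Rightarrow> bool" where
  "closed_subspace_C0 Y \<longleftrightarrow> cfun.subspace Y \<and> closedin C0.mtopology Y"

text \<open>For \<open>int ^ 'n\<close>, which carries the discrete topology, \<open>C0\<close> consists of the functions tending
  to \<open>0\<close> along the complements of finite sets.\<close>

lemma open_int_vec: "open (S :: (int ^ 'n) set)"
  unfolding open_vec_def
proof (intro ballI)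
  fix x assume "x \<in> S"
  then show "\<exists>A. (\<forall>i. open (A i) \<and> x $ i \<in> A i) \<and> (\<forall>y. (\<forall>i. y $ i \<in> A i) \<longrightarrow> y \<in> S)"
    by (intro exI[of _ "\<lambda>i. {x $ i}"]) (auto simp: open_discrete vec_eq_iff[symmetric])
qed

lemma compact_int_vec_iff: "compact (K :: (int ^ 'n) set) \<longleftrightarrow> finite K"
proof
  assume "compact K"
  moreover have "\<forall>c\<in>K. open {c}" "K \<subseteq> (\<Union>c\<in>K. {c})"
    by (auto simp: open_int_vec)
  ultimately obtain D where "D \<subseteq> K" "finite D" "K \<subseteq> (\<Union>c\<in>D. {c})"
    by (metis compactE_image)
  then show "finite K" by (auto intro: finite_subset)
qed (rule finite_imp_compact)

lemma C0_int_vec_iff: "(F :: int ^ 'n \<Rightarrow> complex) \<in> C0 \<longleftrightarrow> (F \<longlongrightarrow> 0) cofinite"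
proof -
  have "(\<exists>K. finite K \<and> (\<forall>\<xi>. \<xi> \<notin> K \<longrightarrow> norm (F \<xi>) < \<epsilon>)) \<longleftrightarrow> finite {\<xi>. \<not> norm (F \<xi>) < \<epsilon>}" for \<epsilon>
    by (auto intro: finite_subset[rotated] exI[of _ "{\<xi>. \<not> norm (F \<xi>) < \<epsilon>}"])
  moreover have "continuous_on UNIV F"
    by (simp add: continuous_on_open_vimage open_int_vec)
  ultimately show ?thesis
    by (simp add: C0_def compact_int_vec_iff tendsto_iff eventually_cofinite)
qed


section \<open>Ranges of the Fourier transform\<close>

definition torus :: "(real ^ 'n) set" where
  "torus = {x. \<forall>i. - pi \<le> x $ i \<and> x $ i < pi}"

definition fourier_R :: "(real ^ 'n \<Rightarrow> complex) \<Rightarrow> real ^ 'n \<Rightarrow> complex" where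
  "fourier_R f \<xi> = (LINT x|lebesgue. exp (- (\<i> * complex_of_real (x \<bullet> \<xi>))) * f x)"

definition fourier_T :: "(real ^ 'n \<Rightarrow> complex) \<Rightarrow> int ^ 'n \<Rightarrow> complex" where
  "fourier_T f \<xi> =
     (LINT x:torus|lebesgue. exp (- (\<i> * complex_of_real (x \<bullet> (\<chi> i. real_of_int (\<xi> $ i))))) * f x)"

definition FL1_R :: "(real ^ 'n \<Rightarrow> complex) set" where
  "FL1_R = fourier_R ` {f. integrable lebesgue f}"

definition FL1_T :: "(int ^ 'n \<Rightarrow> complex) set" where
  "FL1_T = fourier_T ` {f. set_integrable lebesgue torus f}"

end

theory Submission
  imports Defs
begin

text \<open>Reflexivity enters through one consequence: a uniformly bounded sequence in \<open>Y\<close> has a weak limit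
  in \<open>Y\<close> along an ultrafilter on the natural numbers
  (\<open>reflexive_weak_limit\<close>). Each of the steps below builds a bounded sequence whose weak limit
  would be absurd.

  First, all functions in \<open>Y\<close> are controlled by their values on one compact set \<open>K\<close>
  (\<open>reflexive_controlled_by_compact\<close>). Otherwise \<open>Y\<close> contains a sequence of humps of height about
  one with almost disjoint supports, that is, almost the unit vectors of \<open>c\<^sub>0\<close>; their partial sums
  are bounded but have no weak limit. On \<open>\<int>\<^sup>n\<close> compact sets are finite, hence finitely many point
  evaluations separate \<open>Y\<close>, and \<open>Y\<close> is of finite dimension.

  On \<open>\<real>\<^sup>n\<close> this step is not enough, as the space of continuous functions on a compact set has
  reflexive subspaces of infinite dimension. Here the assumption that every \<open>F\<close> in \<open>Y\<close> is the
  transform of some integrable \<open>f\<close> is exploited.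

  The \<open>L\<^sup>1\<close> norm of \<open>f\<close> is, up to a factor 2, the supremum of \<open>\<bar>\<integral> q f\<bar>\<close> over trigonometric
  polynomials \<open>q\<close> bounded by 1 (\<open>sup_multiplier_norming\<close>). But \<open>\<integral> q f\<close> is a finite linear combination
  of values of \<open>F\<close>. Hence \<open>f\<close> is determined by \<open>F\<close>, and its norm is equivalent to a supremum of
  functionals that are continuous for the supremum norm. A construction as in the proof of the
  uniform boundedness principle, with a weak limit in the place of the limit of a Cauchy sequence,
  then bounds the norm of \<open>f\<close> in terms of that of \<open>F\<close> (\<open>inv_fourier_bounded\<close>).

  The preimages of the unit ball of \<open>Y\<close> moreover carry uniformly little mass far from the origin
  (\<open>tail_uniformly_small\<close>): otherwise some of them would place a fixed amount of mass on disjoint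
  annuli moving to infinity, and their weak limit, tested against suitable bounded functions, would
  have that much mass at infinity too. Therefore the unit ball of \<open>Y\<close> is equicontinuous. A function
  in \<open>Y\<close> that vanishes on a fine finite net of \<open>K\<close> is then small on \<open>K\<close> relative to its norm, hence
  zero, so that again finitely many point evaluations separate \<open>Y\<close>.\<close>

section \<open>Weak limits in reflexive spaces\<close>

text \<open>A free ultrafilter: these are the minimal proper filters below \<open>sequentially\<close>.\<close>

definition free_filter :: "nat filter" where
  "free_filter = (SOME U. U \<noteq> bot \<and> U \<le> sequentially \<and>
     (\<forall>V. V \<noteq> bot \<and> V \<le> U \<longrightarrow> V = U))"

lemma free_filter_minimal:
  "free_filter \<noteq> bot" "free_filter \<le> sequentially"
  "V \<noteq> bot \<Longrightarrow> V \<le> free_filter \<Longrightarrow> V = free_filter"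
proof -
  define A where "A = {U :: nat filter. U \<noteq> bot \<and> U \<le> sequentially}"
  define P where "P = (\<lambda>U V :: nat filter. V \<le> U)"
  have po: "partial_order_on A (relation_of P A)"
    by (auto simp: P_def partial_order_on_def preorder_on_def refl_on_def trans_def
        antisym_def relation_of_def)
  have "\<exists>u\<in>A. \<forall>a\<in>C. P a u" if C: "C \<in> Chains (relation_of P A)" for C
  proof (cases "C = {}")
    case True
    then show ?thesis by (intro bexI[of _ sequentially]) (auto simp: A_def)
  next
    case False
    have CA: "C \<subseteq> A" using C by (auto simp: Chains_def relation_of_def)
    have "\<exists>x\<in>C. x \<le> inf F G" if "F \<in> C" "G \<in> C" for F G
    proof -
      have "F \<le> G \<or> G \<le> F" using C that by (auto simp: Chains_def relation_of_def P_def)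
      then show ?thesis using that by (metis inf.absorb1 inf.absorb2 order_refl)
    qed
    from eventually_Inf_base[OF False this]
    have "\<not> eventually (\<lambda>_. False) (Inf C)"
      using CA by (auto simp: A_def trivial_limit_def)
    then have "Inf C \<noteq> bot" by (metis eventually_bot)
    moreover have "Inf C \<le> sequentially"
    proof -
      obtain F where "F \<in> C" using False by blast
      then show ?thesis using CA by (intro Inf_lower2[of F]) (auto simp: A_def)
    qed
    ultimately have "Inf C \<in> A" by (simp add: A_def)
    then show ?thesis unfolding P_def by (blast intro: Inf_lower)
  qed
  from predicate_Zorn[OF po this] obtain U where "U \<in> A" "\<forall>a\<in>A. P U a \<longrightarrow> a = U" by blast
  then have "U \<noteq> bot \<and> U \<le> sequentially \<and> (\<forall>V. V \<noteq> bot \<and> V \<le> U \<longrightarrow> V = U)"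
    unfolding A_def P_def using order_trans by blast
  from someI[of "\<lambda>U. U \<noteq> bot \<and> U \<le> sequentially \<and> (\<forall>V. V \<noteq> bot \<and> V \<le> U \<longrightarrow> V = U)", OF this]
  show "free_filter \<noteq> bot" "free_filter \<le> sequentially"
    "V \<noteq> bot \<Longrightarrow> V \<le> free_filter \<Longrightarrow> V = free_filter"
    unfolding free_filter_def by blast+
qed

lemma eventually_free_filter_ge: "eventually (\<lambda>n. m \<le> n) free_filter"
  using eventually_ge_at_top[of m] free_filter_minimal(2) by (rule filter_leD[rotated])

lemma norm_free_filter_limit_ge:
  fixes x :: "nat \<Rightarrow> complex"
  assumes "(x \<longlongrightarrow> l) free_filter" "\<And>n. m \<le> n \<Longrightarrow> c \<le> norm (x n)"
  shows "c \<le> norm l"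
proof (rule tendsto_lowerbound[OF tendsto_norm[OF assms(1)] _ free_filter_minimal(1)])
  show "eventually (\<lambda>n. c \<le> norm (x n)) free_filter"
    using eventually_free_filter_ge[of m] by eventually_elim (rule assms(2))
qed

lemma norm_free_filter_limit_le:
  fixes x :: "nat \<Rightarrow> complex"
  assumes "(x \<longlongrightarrow> l) free_filter" "\<And>n. m \<le> n \<Longrightarrow> norm (x n) \<le> c"
  shows "norm l \<le> c"
proof (rule tendsto_upperbound[OF tendsto_norm[OF assms(1)] _ free_filter_minimal(1)])
  show "eventually (\<lambda>n. norm (x n) \<le> c) free_filter"
    using eventually_free_filter_ge[of m] by eventually_elim (rule assms(2))
qed

text \<open>By compactness the sequence has a cluster point along the filter. Restricting the filter to the
  neighbourhoods of the cluster point leaves it proper, hence by minimality unchanged.\<close>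

lemma bounded_imp_convergent_free_filter:
  fixes x :: "nat \<Rightarrow> complex"
  assumes "\<And>n. norm (x n) \<le> C"
  shows "\<exists>l. (x \<longlongrightarrow> l) free_filter"
proof -
  have "compact (cball (0::complex) C)" by simp
  moreover have "filtermap x free_filter \<noteq> bot"
    by (simp add: filtermap_bot_iff free_filter_minimal(1))
  moreover have "eventually (\<lambda>z. z \<in> cball 0 C) (filtermap x free_filter)"
    using assms by (simp add: eventually_filtermap)
  ultimately obtain l where l: "inf (nhds l) (filtermap x free_filter) \<noteq> bot"
    unfolding compact_filter by blast
  define V where "V = inf free_filter (filtercomap x (nhds l))"
  have "V \<noteq> bot"
  proof
    assume "V = bot"
    then have "eventually (\<lambda>_. False) V" by simp
    then obtain P Q where PQ: "eventually P free_filter" "eventually Q (filtercomap x (nhds l))"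
      "\<And>n. P n \<Longrightarrow> Q n \<Longrightarrow> False"
      unfolding V_def eventually_inf by blast
    then obtain R where R: "eventually R (nhds l)" "\<And>n. R (x n) \<Longrightarrow> Q n"
      unfolding eventually_filtercomap by blast
    have "eventually (\<lambda>z. \<not> R z) (filtermap x free_filter)"
      unfolding eventually_filtermap using PQ(1) by eventually_elim (use PQ(3) R(2) in blast)
    then have "eventually (\<lambda>_. False) (inf (nhds l) (filtermap x free_filter))"
      unfolding eventually_inf using R(1) by blast
    with l show False by (simp add: trivial_limit_def)
  qed
  moreover have "V \<le> free_filter" unfolding V_def by simp
  ultimately have "V = free_filter" by (rule free_filter_minimal(3))
  then have "free_filter \<le> filtercomap x (nhds l)" unfolding V_def by (metis inf.cobounded2)
  then show ?thesis by (auto simp: filterlim_def filtermap_le_iff_le_filtercomap)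
qed

lemma norm_le_sup_norm: "F \<in> C0 \<Longrightarrow> norm (F \<xi>) \<le> sup_norm F"
  unfolding sup_norm_def by (rule cSUP_upper[OF UNIV_I C0_bounded])

lemma sup_norm_le: "(\<And>\<xi>. norm (F \<xi>) \<le> M) \<Longrightarrow> sup_norm F \<le> M"
  unfolding sup_norm_def by (rule cSUP_least) auto

lemma mem_dualI:
  assumes "\<And>F G. F \<in> Y \<Longrightarrow> G \<in> Y \<Longrightarrow> \<phi> (F + G) = \<phi> F + \<phi> G"
    and "\<And>c F. F \<in> Y \<Longrightarrow> \<phi> (cscale c F) = c * \<phi> F"
    and "\<And>F. F \<in> Y \<Longrightarrow> norm (\<phi> F) \<le> K * N F"
    and "\<And>F. F \<notin> Y \<Longrightarrow> \<phi> F = 0"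
  shows "\<phi> \<in> dual Y N"
  using assms unfolding dual_def by blast

lemma eval_in_dual:
  assumes "Y \<subseteq> C0" "cfun.subspace Y"
  shows "(\<lambda>F. if F \<in> Y then F \<xi> else 0) \<in> dual Y sup_norm"
proof (rule mem_dualI[where K = 1])
  show "\<And>F. F \<in> Y \<Longrightarrow> norm (if F \<in> Y then F \<xi> else 0) \<le> 1 * sup_norm F"
    using assms(1) norm_le_sup_norm by auto
qed (use assms(2) in \<open>auto simp: cfun.subspace_add cfun.subspace_scale, auto simp: cscale_def\<close>)

text \<open>As \<open>dual_norm\<close> is a supremum of reals, it bounds anything only because the functional is bounded
  on the unit ball.\<close>

lemma norm_functional_le_dual_norm:
  assumes Y: "Y \<subseteq> C0" "cfun.subspace Y" and phi: "\<phi> \<in> dual Y sup_norm"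
    and F: "F \<in> Y" "\<And>\<xi>. norm (F \<xi>) \<le> C" and C: "C > 0"
  shows "norm (\<phi> F) \<le> C * dual_norm Y sup_norm \<phi>"
proof -
  obtain K where K: "\<And>G. G \<in> Y \<Longrightarrow> norm (\<phi> G) \<le> K * sup_norm G"
    using phi unfolding dual_def by blast
  have bd: "norm (\<phi> G) \<le> \<bar>K\<bar>" if "G \<in> Y" "sup_norm G \<le> 1" for G
  proof -
    have "0 \<le> sup_norm G"
      using norm_le_sup_norm[of G undefined] that(1) Y(1) norm_ge_zero order_trans by blast
    then have "K * sup_norm G \<le> \<bar>K\<bar> * 1"
      using that(2) by (intro mult_mono) auto
    then show ?thesis using K[OF that(1)] by simp
  qed
  let ?G = "cscale (1 / complex_of_real C) F"
  have G: "?G \<in> Y" using Y(2) F(1) by (rule cfun.subspace_scale)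
  moreover have "sup_norm ?G \<le> 1"
    using F(2) C by (intro sup_norm_le) (auto simp: cscale_def norm_mult norm_divide field_simps)
  ultimately have "norm (\<phi> ?G) \<le> dual_norm Y sup_norm \<phi>"
    unfolding dual_norm_def using bd by (intro cSUP_upper bdd_aboveI2) auto
  moreover have "norm (\<phi> ?G) = norm (\<phi> F) / C"
    using phi F(1) C unfolding dual_def by (simp add: norm_mult norm_divide)
  ultimately show ?thesis using C by (simp add: field_simps)
qed

text \<open>The scalar limits of \<open>\<phi> (G m)\<close> define a bounded functional of \<open>\<phi>\<close>, that is, an element of the
  bidual; reflexivity provides the element of \<open>Y\<close> that represents it.\<close>

lemma reflexive_weak_limit:
  assumes Y: "Y \<subseteq> C0" "cfun.subspace Y" "reflexive Y sup_norm"
    and G: "\<And>m. G m \<in> Y" "\<And>m \<xi>. norm (G m \<xi>) \<le> C"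
  shows "\<exists>H\<in>Y. \<forall>\<phi>\<in>dual Y sup_norm. ((\<lambda>m. \<phi> (G m)) \<longlongrightarrow> \<phi> H) free_filter"
proof -
  define C' where "C' = max C 1"
  have C': "C' > 0" "\<And>m \<xi>. norm (G m \<xi>) \<le> C'"
    using G(2) by (auto simp: C'_def le_max_iff_disj)
  let ?D = "dual Y sup_norm"
  have bd: "norm (\<phi> (G m)) \<le> C' * dual_norm Y sup_norm \<phi>" if "\<phi> \<in> ?D" for \<phi> m
    using norm_functional_le_dual_norm[OF Y(1,2) that G(1)] C' by blast
  define \<Lambda> where
    "\<Lambda> = (\<lambda>\<phi>. if \<phi> \<in> ?D then Lim free_filter (\<lambda>m. \<phi> (G m)) else 0)"
  have conv: "((\<lambda>m. \<phi> (G m)) \<longlongrightarrow> \<Lambda> \<phi>) free_filter" if "\<phi> \<in> ?D" for \<phi>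
    using bounded_imp_convergent_free_filter[of "\<lambda>m. \<phi> (G m)", OF bd[OF that]] that
    by (auto simp: \<Lambda>_def tendsto_Lim free_filter_minimal(1))
  have Dadd: "\<phi> + \<psi> \<in> ?D" if "\<phi> \<in> ?D" "\<psi> \<in> ?D" for \<phi> \<psi>
  proof -
    obtain K where K: "\<And>F. F \<in> Y \<Longrightarrow> norm (\<phi> F) \<le> K * sup_norm F"
      using \<open>\<phi> \<in> ?D\<close> unfolding dual_def by blast
    obtain L where L: "\<And>F. F \<in> Y \<Longrightarrow> norm (\<psi> F) \<le> L * sup_norm F"
      using \<open>\<psi> \<in> ?D\<close> unfolding dual_def by blast
    from K L have "norm ((\<phi> + \<psi>) F) \<le> (K + L) * sup_norm F" if "F \<in> Y" for F
      using that norm_triangle_ineq[of "\<phi> F" "\<psi> F"] by (fastforce simp: algebra_simps)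
    moreover have "(\<phi> + \<psi>) (F + H) = (\<phi> + \<psi>) F + (\<phi> + \<psi>) H" if "F \<in> Y" "H \<in> Y" for F H
      using \<open>\<phi> \<in> ?D\<close> \<open>\<psi> \<in> ?D\<close> that unfolding dual_def by simp
    moreover have "(\<phi> + \<psi>) (cscale c F) = c * (\<phi> + \<psi>) F" if "F \<in> Y" for c F
      using \<open>\<phi> \<in> ?D\<close> \<open>\<psi> \<in> ?D\<close> that unfolding dual_def by (simp add: algebra_simps)
    ultimately show ?thesis
      using \<open>\<phi> \<in> ?D\<close> \<open>\<psi> \<in> ?D\<close> by (intro mem_dualI) (auto simp: dual_def)
  qed
  have Dscale: "cscale c \<phi> \<in> ?D" if "\<phi> \<in> ?D" for \<phi> c
  proof -
    obtain K where "\<And>F. F \<in> Y \<Longrightarrow> norm (\<phi> F) \<le> K * sup_norm F"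
      using \<open>\<phi> \<in> ?D\<close> unfolding dual_def by blast
    then have "norm (cscale c \<phi> F) \<le> (norm c * K) * sup_norm F" if "F \<in> Y" for F
      using that by (simp add: cscale_def norm_mult mult.assoc mult_left_mono)
    then show ?thesis
      using that by (intro mem_dualI[where K = "norm c * K"]) (auto simp: dual_def, auto simp: cscale_def algebra_simps)
  qed
  have "\<Lambda> \<in> dual ?D (dual_norm Y sup_norm)"
  proof (rule mem_dualI)
    fix \<phi> \<psi> assume *: "\<phi> \<in> ?D" "\<psi> \<in> ?D"
    from conv[OF Dadd[OF *]] tendsto_add[OF conv[OF *(1)] conv[OF *(2)]]
    show "\<Lambda> (\<phi> + \<psi>) = \<Lambda> \<phi> + \<Lambda> \<psi>"
      by (auto intro: tendsto_unique[OF free_filter_minimal(1)])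
  next
    fix c \<phi> assume *: "\<phi> \<in> ?D"
    from conv[OF Dscale[OF *]] tendsto_mult[OF tendsto_const conv[OF *]]
    show "\<Lambda> (cscale c \<phi>) = c * \<Lambda> \<phi>"
      by (auto simp: cscale_def intro: tendsto_unique[OF free_filter_minimal(1)])
  next
    fix \<phi> assume *: "\<phi> \<in> ?D"
    show "norm (\<Lambda> \<phi>) \<le> C' * dual_norm Y sup_norm \<phi>"
      by (rule norm_free_filter_limit_le[OF conv[OF *] bd[OF *]])
  qed (simp add: \<Lambda>_def)
  then obtain H where "H \<in> Y" "\<forall>\<phi>\<in>?D. \<Lambda> \<phi> = \<phi> H"
    using Y(3) unfolding reflexive_def by blast
  then show ?thesis using conv by (intro bexI[of _ H]) auto
qed


section \<open>Control by a compact set\<close>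

text \<open>Suppose that for no \<open>K\<close> and \<open>C\<close> the conclusion holds. Then there are functions \<open>F j\<close> in \<open>Y\<close> of
  supremum norm at most 1, and points \<open>\<xi> j\<close> with \<open>\<bar>F j (\<xi> j)\<bar> \<ge> 1 / 2\<close>, such that \<open>F j\<close> is tiny
  outside the difference \<open>K (Suc j) - K j\<close> for an increasing sequence of compact sets. The partial
  sums \<open>G m\<close> are bounded, so they have a weak limit \<open>H\<close>, and evaluation at \<open>\<xi> k\<close> gives
  \<open>\<bar>H (\<xi> k)\<bar> \<ge> 3 / 8\<close> for all \<open>k\<close>. The functional \<open>\<phi>\<close> that takes the limit of the values at \<open>\<xi> k\<close> for
  \<open>k\<close> to infinity is at least \<open>3 / 8\<close> in modulus on \<open>H\<close>, but at most \<open>1 / 8\<close> on every \<open>G m\<close>, as \<open>G m\<close> is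
  tiny at the later points. This contradicts weak convergence.\<close>

lemma reflexive_controlled_by_compact:
  fixes Y :: "('a::topological_space \<Rightarrow> complex) set"
  assumes Y: "Y \<subseteq> C0" "cfun.subspace Y" "reflexive Y sup_norm"
  shows "\<exists>K C. compact K \<and> C \<ge> 0 \<and>
    (\<forall>F\<in>Y. \<forall>M\<ge>0. (\<forall>\<xi>\<in>K. norm (F \<xi>) \<le> M) \<longrightarrow> (\<forall>\<xi>. norm (F \<xi>) \<le> C * M))"
proof (rule ccontr)
  assume neg: "\<not> ?thesis"
  have hump: "\<exists>F\<in>Y. (\<forall>\<xi>. norm (F \<xi>) \<le> 1) \<and> (\<forall>\<xi>\<in>K. norm (F \<xi>) < c) \<and> (\<exists>\<xi>. norm (F \<xi>) \<ge> 1 / 2)"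
    if K: "compact K" and c: "c > 0" for K :: "'a set" and c :: real
  proof -
    have "compact K \<and> 0 \<le> 2 / c" using K c by simp
    then have "\<not> (\<forall>F\<in>Y. \<forall>M\<ge>0. (\<forall>\<xi>\<in>K. norm (F \<xi>) \<le> M) \<longrightarrow> (\<forall>\<xi>. norm (F \<xi>) \<le> 2 / c * M))"
      using neg by blast
    then obtain F M \<xi>0 where F: "F \<in> Y" and M: "M \<ge> 0" "\<And>\<xi>. \<xi> \<in> K \<Longrightarrow> norm (F \<xi>) \<le> M"
      and \<xi>0: "norm (F \<xi>0) > 2 / c * M"
      unfolding not_le[symmetric] by blast
    define s where "s = sup_norm F"
    have le: "norm (F \<xi>) \<le> s" for \<xi> unfolding s_def using F Y(1) by (auto intro: norm_le_sup_norm)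
    have "2 / c * M < s" using \<xi>0 le[of \<xi>0] by simp
    then have sM: "M < s * c / 2" using c by (simp add: field_simps)
    then have s: "s > 0" using M(1) c by (smt (verit) zero_less_mult_iff divide_pos_pos zero_less_divide_iff)
    have "\<exists>\<xi>. norm (F \<xi>) > s / 2"
    proof (rule ccontr)
      assume "\<not> ?thesis"
      then have "sup_norm F \<le> s / 2" by (intro sup_norm_le) (simp add: not_less)
      then show False using s by (simp add: s_def)
    qed
    then obtain \<xi>1 where \<xi>1: "norm (F \<xi>1) > s / 2" by blast
    let ?F = "cscale (1 / complex_of_real s) F"
    have nF: "norm (?F \<xi>) = norm (F \<xi>) / s" for \<xi> using s by (simp add: cscale_def norm_mult norm_divide)
    show ?thesis
    proof (intro bexI conjI allI ballI exI)
      show "?F \<in> Y" using F Y(2) by (simp add: cfun.subspace_scale)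
      show "norm (?F \<xi>) \<le> 1" for \<xi> unfolding nF using le[of \<xi>] s by (simp add: field_simps)
      show "norm (?F \<xi>1) \<ge> 1 / 2" unfolding nF using \<xi>1 s by (simp add: field_simps)
      show "norm (?F \<xi>) < c" if "\<xi> \<in> K" for \<xi>
      proof -
        have "norm (F \<xi>) < s * c" using M(2)[OF that] sM s c by (smt (verit) field_sum_of_halves mult_pos_pos)
        then show ?thesis unfolding nF using s by (simp add: field_simps)
      qed
    qed
  qed
  \<comment> \<open>Tolerances whose sum, at most \<open>1 / 8\<close>, stays well below the height \<open>1 / 2\<close> of a hump.\<close>
  define e :: "nat \<Rightarrow> real" where "e n = (1 / 2) ^ n / 16" for n
  have e: "e n > 0" "e n < 1 / 2" for n
  proof -
    have "(1 / 2 :: real) ^ n \<le> 1" by (simp add: power_le_one)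
    then show "e n > 0" "e n < 1 / 2" by (auto simp: e_def)
  qed
  have sum_e: "(\<Sum>j<m. e j) \<le> 1 / 8" for m
  proof -
    have "(\<Sum>j<m. e j) = 1 / 8 - (1 / 2) ^ m / 8" by (induction m) (auto simp: e_def)
    then show ?thesis by simp
  qed
  define R where "R n K F \<xi> K' \<longleftrightarrow> F \<in> Y \<and> (\<forall>\<eta>. norm (F \<eta>) \<le> 1) \<and> (\<forall>\<eta>\<in>K. norm (F \<eta>) < e n) \<and>
      norm (F \<xi>) \<ge> 1 / 2 \<and> K \<subseteq> K' \<and> (\<forall>\<eta>. \<eta> \<notin> K' \<longrightarrow> norm (F \<eta>) < e n)"
    for n K F \<xi> K'
  have "\<exists>K. \<forall>n. compact (K n) \<and> (\<exists>F \<xi>. R n (K n) F \<xi> (K (Suc n)))"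
  proof (rule dependent_nat_choice)
    show "\<exists>K :: 'a set. compact K" using compact_empty by blast
    fix K :: "'a set" and n assume K: "compact K"
    obtain F \<xi> where F: "F \<in> Y" "\<forall>\<xi>. norm (F \<xi>) \<le> 1" "\<forall>\<xi>\<in>K. norm (F \<xi>) < e n" "norm (F \<xi>) \<ge> 1 / 2"
      using hump[OF K e(1)[of n]] by blast
    then obtain L where L: "compact L" "\<forall>\<xi>. \<xi> \<notin> L \<longrightarrow> norm (F \<xi>) < e n"
    proof -
      have "F \<in> C0" using F(1) Y(1) by blast
      then have "\<exists>L. compact L \<and> (\<forall>\<xi>. \<xi> \<notin> L \<longrightarrow> norm (F \<xi>) < e n)"
        using e(1)[of n] unfolding C0_def by simp
      then show ?thesis using that by blast
    qed
    show "\<exists>K'. compact K' \<and> (\<exists>F \<xi>. R n K F \<xi> K')"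
      using F L K by (intro exI[of _ "K \<union> L"] conjI exI[of _ F] exI[of _ \<xi>]) (auto simp: R_def)
  qed
  then obtain K where K: "\<forall>n. \<exists>F \<xi>. R n (K n) F \<xi> (K (Suc n))" by blast
  obtain F where F: "\<forall>n. \<exists>\<xi>. R n (K n) (F n) \<xi> (K (Suc n))" using choice[OF K] by blast
  obtain \<xi> where R: "\<forall>n. R n (K n) (F n) (\<xi> n) (K (Suc n))" using choice[OF F] by blast
  have FY: "F n \<in> Y" and F1: "norm (F n \<eta>) \<le> 1" and F\<xi>: "norm (F n (\<xi> n)) \<ge> 1 / 2"
    and small: "\<eta> \<in> K n \<or> \<eta> \<notin> K (Suc n) \<Longrightarrow> norm (F n \<eta>) < e n" for n \<eta>
    using R[rule_format, of n] unfolding R_def by auto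
  have K_mono: "K i \<subseteq> K j" if "i \<le> j" for i j
    by (rule lift_Suc_mono_le[OF _ that]) (use R in \<open>simp add: R_def\<close>)
  have \<xi>K: "\<xi> k \<notin> K k" "\<xi> k \<in> K (Suc k)" for k
  proof -
    have "\<not> norm (F k (\<xi> k)) < e k" using F\<xi>[of k] e(2)[of k] by linarith
    then show "\<xi> k \<notin> K k" "\<xi> k \<in> K (Suc k)" using small by blast+
  qed
  \<comment> \<open>The differences \<open>K (Suc j) - K j\<close> are disjoint, so at most one hump is large at a given point.\<close>
  have single: "\<exists>j0. \<forall>j. j \<noteq> j0 \<longrightarrow> norm (F j \<eta>) < e j" for \<eta>
  proof -
    have "False" if "\<not> norm (F i \<eta>) < e i" "\<not> norm (F j \<eta>) < e j" "i < j" for i j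
      using small[of \<eta> i] small[of \<eta> j] K_mono[of "Suc i" j] that by auto
    then show ?thesis by (metis linorder_neqE_nat)
  qed
  have other: "norm (F j (\<xi> k)) < e j" if "j \<noteq> k" for j k
  proof -
    obtain j0 where "\<forall>j. j \<noteq> j0 \<longrightarrow> norm (F j (\<xi> k)) < e j" using single by blast
    then show ?thesis using F\<xi>[of k] e(2)[of k] that by (metis less_le_not_le order.strict_trans2)
  qed
  define G where "G m = (\<lambda>\<eta>. \<Sum>j<m. F j \<eta>)" for m
  have GY: "G m \<in> Y" for m
  proof (induction m)
    case 0
    have "G 0 = 0" by (simp add: G_def zero_fun_def)
    then show ?case using cfun.subspace_0[OF Y(2)] by metis
  next
    case (Suc m)
    have "G (Suc m) = G m + F m" by (simp add: G_def plus_fun_def)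
    then show ?case using cfun.subspace_add[OF Y(2) Suc FY[of m]] by metis
  qed
  have G_le: "norm (G m \<eta>) \<le> 2" for m \<eta>
  proof -
    obtain j0 where j0: "\<forall>j. j \<noteq> j0 \<longrightarrow> norm (F j \<eta>) < e j" using single by blast
    have "norm (G m \<eta>) \<le> (\<Sum>j<m. norm (F j \<eta>))" unfolding G_def by (rule norm_sum)
    also have "\<dots> \<le> (\<Sum>j<m. e j + (if j = j0 then 1 else 0))"
      using j0 F1 e(1) by (intro sum_mono) (auto simp: add_increasing less_imp_le)
    also have "\<dots> = (\<Sum>j<m. e j) + (if j0 < m then 1 else 0)"
      by (simp add: sum.distrib)
    also have "\<dots> \<le> 2" using sum_e[of m] by auto
    finally show ?thesis .
  qed
  have G_ge: "norm (G m (\<xi> k)) \<ge> 3 / 8" if "k < m" for k m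
  proof -
    have "norm (\<Sum>j\<in>{..<m}-{k}. F j (\<xi> k)) \<le> (\<Sum>j\<in>{..<m}-{k}. e j)"
      using other by (intro sum_norm_le) (auto simp: less_imp_le)
    also have "\<dots> \<le> (\<Sum>j<m. e j)" using e(1) by (intro sum_mono2) (auto simp: less_imp_le)
    finally have "norm (\<Sum>j\<in>{..<m}-{k}. F j (\<xi> k)) \<le> 1 / 8" using sum_e[of m] by simp
    moreover have "G m (\<xi> k) = F k (\<xi> k) + (\<Sum>j\<in>{..<m}-{k}. F j (\<xi> k))"
      unfolding G_def using that by (intro sum.remove) auto
    ultimately show ?thesis
      using F\<xi>[of k] norm_diff_ineq[of "F k (\<xi> k)" "\<Sum>j\<in>{..<m}-{k}. F j (\<xi> k)"] by simp
  qed
  have G_small: "norm (G m (\<xi> k)) \<le> 1 / 8" if "m \<le> k" for k m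
  proof -
    have "norm (G m (\<xi> k)) \<le> (\<Sum>j<m. e j)"
      unfolding G_def using other that by (intro sum_norm_le) (auto simp: less_imp_le)
    then show ?thesis using sum_e[of m] by simp
  qed
  obtain H where H: "H \<in> Y" "\<And>\<phi>. \<phi> \<in> dual Y sup_norm \<Longrightarrow> ((\<lambda>m. \<phi> (G m)) \<longlongrightarrow> \<phi> H) free_filter"
    using reflexive_weak_limit[of Y G 2, OF Y GY G_le] by blast
  have H_ge: "norm (H (\<xi> k)) \<ge> 3 / 8" for k
  proof -
    have "((\<lambda>m. G m (\<xi> k)) \<longlongrightarrow> H (\<xi> k)) free_filter"
      using H(2)[OF eval_in_dual[OF Y(1,2), of "\<xi> k"]] H(1) GY by simp
    then show ?thesis
      by (rule norm_free_filter_limit_ge[where m = "Suc k"]) (use G_ge in \<open>simp only: Suc_le_eq\<close>)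
  qed
  define \<phi> where "\<phi> E = (if E \<in> Y then Lim free_filter (\<lambda>k. E (\<xi> k)) else 0)" for E
  have \<phi>: "((\<lambda>k. E (\<xi> k)) \<longlongrightarrow> \<phi> E) free_filter" if "E \<in> Y" for E
    using bounded_imp_convergent_free_filter[of "\<lambda>k. E (\<xi> k)" "sup_norm E"] norm_le_sup_norm[of E] Y(1) that
    by (auto simp: \<phi>_def tendsto_Lim free_filter_minimal(1) subset_iff)
  have unique: "\<phi> E = l" if "E \<in> Y" "((\<lambda>k. E (\<xi> k)) \<longlongrightarrow> l) free_filter" for E l
    using \<phi> that by (blast intro: tendsto_unique[OF free_filter_minimal(1)])
  have "\<phi> \<in> dual Y sup_norm"
  proof (rule mem_dualI[where K = 1])
    fix E E' assume *: "E \<in> Y" "E' \<in> Y"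
    show "\<phi> (E + E') = \<phi> E + \<phi> E'"
      using tendsto_add[OF \<phi>[OF *(1)] \<phi>[OF *(2)]] * Y(2) by (intro unique) (auto simp: cfun.subspace_add)
  next
    fix c E assume *: "E \<in> Y"
    show "\<phi> (cscale c E) = c * \<phi> E"
      using tendsto_mult[OF tendsto_const \<phi>[OF *], of c] * Y(2)
      by (intro unique) (auto simp: cfun.subspace_scale, simp add: cscale_def)
  next
    fix E assume *: "E \<in> Y"
    show "norm (\<phi> E) \<le> 1 * sup_norm E"
      using norm_free_filter_limit_le[OF \<phi>[OF *], of 0 "sup_norm E"] norm_le_sup_norm[of E] * Y(1) by auto
  qed (simp add: \<phi>_def)
  then have "norm (\<phi> H) \<le> 1 / 8"
  proof (rule norm_free_filter_limit_le[OF H(2)])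
    show "norm (\<phi> (G m)) \<le> 1 / 8" for m
      by (rule norm_free_filter_limit_le[OF \<phi>[OF GY] G_small])
  qed
  moreover have "norm (\<phi> H) \<ge> 3 / 8"
    by (rule norm_free_filter_limit_ge[OF \<phi>[OF H(1)] H_ge])
  ultimately show False by simp
qed

text \<open>Removing one point from \<open>P\<close> corresponds to passing to the kernel of one evaluation, a subspace of
  codimension at most 1.\<close>

lemma finite_dim_of_finite_determining_set:
  assumes "finite P" "cfun.subspace Y" "\<And>F. F \<in> Y \<Longrightarrow> (\<And>p. p \<in> P \<Longrightarrow> F p = 0) \<Longrightarrow> F = 0"
  shows "finite_dim Y"
  using assms
proof (induction P arbitrary: Y rule: finite_induct)
  case empty
  then have "Y \<subseteq> {0}" "0 \<in> Y"
    by (blast, intro cfun.subspace_0)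
  then have "Y = cfun.span {}" by (simp add: subset_singleton_iff) blast
  then show ?case unfolding finite_dim_def by blast
next
  case (insert p P)
  define Y0 where "Y0 = {F \<in> Y. F p = 0}"
  have "cfun.subspace Y0"
    using insert.prems(1) unfolding Y0_def cfun.subspace_def by (auto simp: cscale_def)
  moreover have "F = 0" if "F \<in> Y0" "\<And>q. q \<in> P \<Longrightarrow> F q = 0" for F
    using that by (intro insert.prems(2)) (auto simp: Y0_def)
  ultimately obtain B where B: "finite B" "Y0 = cfun.span B"
    using insert.IH unfolding finite_dim_def by meson
  show ?case
  proof (cases "Y0 = Y")
    case True
    then show ?thesis using B unfolding finite_dim_def by blast
  next
    case False
    then obtain E where E: "E \<in> Y" "E p \<noteq> 0" unfolding Y0_def by blast
    have "Y = cfun.span (insert E B)"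
    proof
      show "cfun.span (insert E B) \<subseteq> Y"
      proof (rule cfun.span_minimal[OF _ insert.prems(1)])
        have "B \<subseteq> Y0" using B(2) cfun.span_superset by blast
        then show "insert E B \<subseteq> Y" using E by (auto simp: Y0_def)
      qed
      show "Y \<subseteq> cfun.span (insert E B)"
      proof
        fix F assume F: "F \<in> Y"
        let ?c = "F p / E p"
        have "F - cscale ?c E \<in> Y"
          using F E(1) insert.prems(1) by (simp add: cfun.subspace_diff cfun.subspace_scale)
        then have "F - cscale ?c E \<in> cfun.span B"
          using E(2) unfolding B(2)[symmetric] Y0_def by (simp add: cscale_def)
        then show "F \<in> cfun.span (insert E B)"
          unfolding cfun.span_insert by blast
      qed
    qed
    then show ?thesis using B(1) unfolding finite_dim_def by blast
  qed
qed

lemma reflexive_finite_dim_discrete: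
  fixes Y :: "(int ^ 'n \<Rightarrow> complex) set"
  assumes "Y \<subseteq> C0" "cfun.subspace Y" "reflexive Y sup_norm"
  shows "finite_dim Y"
proof -
  obtain K C where K: "compact K"
    "\<forall>F\<in>Y. \<forall>M\<ge>0. (\<forall>\<xi>\<in>K. norm (F \<xi>) \<le> M) \<longrightarrow> (\<forall>\<xi>. norm (F \<xi>) \<le> C * M)"
    using reflexive_controlled_by_compact[OF assms] by blast
  have "F = 0" if "F \<in> Y" "\<And>\<xi>. \<xi> \<in> K \<Longrightarrow> F \<xi> = 0" for F
    using K(2)[rule_format, of F 0] that by (auto simp: zero_fun_def)
  then show ?thesis
    using finite_dim_of_finite_determining_set[of K Y] K(1) assms(2) compact_int_vec_iff by blast
qed

section \<open>Elementary properties of the Fourier transform\<close>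

lemma integrable_bounded_mult:
  fixes f g :: "'a::euclidean_space \<Rightarrow> complex"
  assumes f: "integrable lebesgue f" and g: "g \<in> borel_measurable lebesgue" "\<And>x. norm (g x) \<le> C"
  shows "integrable lebesgue (\<lambda>x. g x * f x)"
    and "norm (LINT x|lebesgue. g x * f x) \<le> C * (LINT x|lebesgue. norm (f x))"
proof -
  have "C \<ge> 0" using g(2) norm_ge_zero order_trans by blast
  have m: "f \<in> borel_measurable lebesgue" using f by (rule borel_measurable_integrable)
  have le: "norm (g x * f x) \<le> C * norm (f x)" for x
    using g(2) by (simp add: norm_mult mult_right_mono)
  have i: "integrable lebesgue (\<lambda>x. C * norm (f x))"
    using f by simp
  show 1: "integrable lebesgue (\<lambda>x. g x * f x)"
    by (rule Bochner_Integration.integrable_bound[OF i]) (use m g(1) le \<open>C \<ge> 0\<close> in \<open>auto simp: abs_mult\<close>)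
  have "norm (LINT x|lebesgue. g x * f x) \<le> (LINT x|lebesgue. norm (g x * f x))"
    by (rule integral_norm_bound)
  also have "\<dots> \<le> (LINT x|lebesgue. C * norm (f x))"
    using 1 i le by (intro integral_mono) auto
  finally show "norm (LINT x|lebesgue. g x * f x) \<le> C * (LINT x|lebesgue. norm (f x))" by simp
qed

lemma continuous_imp_measurable_lebesgue:
  fixes g :: "'a::euclidean_space \<Rightarrow> complex"
  shows "continuous_on UNIV g \<Longrightarrow> g \<in> borel_measurable lebesgue"
  by (simp add: borel_measurable_continuous_onI measurable_completion)

lemma char_measurable:
  "(\<lambda>x. exp (- (\<i> * complex_of_real (x \<bullet> \<xi>)))) \<in> borel_measurable (lebesgue :: 'a::euclidean_space measure)"
  by (intro continuous_imp_measurable_lebesgue continuous_intros)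

lemma integrable_char_mult:
  fixes f :: "'a::euclidean_space \<Rightarrow> complex"
  assumes "integrable lebesgue f"
  shows "integrable lebesgue (\<lambda>x. exp (- (\<i> * complex_of_real (x \<bullet> \<xi>))) * f x)"
  by (rule integrable_bounded_mult(1)[OF assms char_measurable, where C = 1]) simp

lemma fourier_R_add:
  assumes "integrable lebesgue f" "integrable lebesgue g"
  shows "fourier_R (\<lambda>x. f x + g x) \<xi> = fourier_R f \<xi> + fourier_R g \<xi>"
  unfolding fourier_R_def distrib_left
  by (intro Bochner_Integration.integral_add integrable_char_mult assms)

lemma fourier_R_cmult: "fourier_R (\<lambda>x. c * f x) \<xi> = c * fourier_R f \<xi>"
  unfolding fourier_R_def mult.left_commute[of _ c] by simp

text \<open>Modulation becomes translation, which does not affect the supremum norm.\<close>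

lemma fourier_R_char_mult:
  "fourier_R (\<lambda>x. exp (- (\<i> * complex_of_real (x \<bullet> \<eta>))) * f x) \<xi> = fourier_R f (\<xi> + \<eta>)"
proof -
  have "exp (- (\<i> * complex_of_real (x \<bullet> (\<xi> + \<eta>)))) =
      exp (- (\<i> * complex_of_real (x \<bullet> \<xi>))) * exp (- (\<i> * complex_of_real (x \<bullet> \<eta>)))" for x
    by (simp add: inner_add_right distrib_left flip: exp_add)
  then show ?thesis by (simp add: fourier_R_def mult.assoc)
qed


section \<open>Trigonometric multipliers and the injectivity of the Fourier transform\<close>

definition fourier_dominated :: "real \<Rightarrow> (real ^ 'n \<Rightarrow> complex) \<Rightarrow> bool" where
  "fourier_dominated C q \<longleftrightarrow> (\<forall>f M \<xi>. integrable lebesgue f \<longrightarrow> (\<forall>\<eta>. norm (fourier_R f \<eta>) \<le> M) \<longrightarrow>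
     norm (fourier_R (\<lambda>x. q x * f x) \<xi>) \<le> C * M)"

text \<open>Every trigonometric polynomial (a linear combination of characters \<open>exp (- \<i> x \<bullet> \<eta>)\<close>) has the
  following property, because multiplying \<open>f\<close> by it turns the transform of \<open>f\<close> into a linear
  combination of translates. The property asks for control of all values of the transform of \<open>q f\<close>, and not only of
  \<open>\<integral> q f\<close>, its value at 0, because in this form it passes to products.\<close>

definition sup_multiplier :: "(real ^ 'n \<Rightarrow> complex) \<Rightarrow> bool" where
  "sup_multiplier q \<longleftrightarrow> continuous_on UNIV q \<and> (\<exists>B. \<forall>x. norm (q x) \<le> B) \<and>
     (\<exists>C\<ge>0. fourier_dominated C q)"

lemma fourier_dominatedI:
  assumes "\<And>f M \<xi>. integrable lebesgue f \<Longrightarrow> (\<And>\<xi>. norm (fourier_R f \<xi>) \<le> M) \<Longrightarrow>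
      norm (fourier_R (\<lambda>x. q x * f x) \<xi>) \<le> C * M"
  shows "fourier_dominated C q"
  using assms unfolding fourier_dominated_def by blast

lemma fourier_dominatedD:
  assumes "fourier_dominated C q" "integrable lebesgue f" "\<And>\<xi>. norm (fourier_R f \<xi>) \<le> M"
  shows "norm (fourier_R (\<lambda>x. q x * f x) \<xi>) \<le> C * M"
  using assms unfolding fourier_dominated_def by blast

lemma sup_multiplierI:
  assumes "continuous_on UNIV q" "\<And>x. norm (q x) \<le> B" "C \<ge> 0"
    and "\<And>f M \<xi>. integrable lebesgue f \<Longrightarrow> (\<And>\<xi>. norm (fourier_R f \<xi>) \<le> M) \<Longrightarrow>
      norm (fourier_R (\<lambda>x. q x * f x) \<xi>) \<le> C * M"
  shows "sup_multiplier q"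
  using assms fourier_dominatedI unfolding sup_multiplier_def by blast

lemma sup_multiplierE:
  assumes "sup_multiplier q"
  obtains B C where "continuous_on UNIV q" "\<And>x. norm (q x) \<le> B" "C \<ge> 0" "fourier_dominated C q"
  using assms unfolding sup_multiplier_def by blast

lemma sup_multiplier_integrable:
  assumes "sup_multiplier q" "integrable lebesgue f"
  shows "integrable lebesgue (\<lambda>x. q x * f x)"
  using assms by (elim sup_multiplierE) (blast intro: integrable_bounded_mult continuous_imp_measurable_lebesgue)

lemma sup_multiplier_const: "sup_multiplier (\<lambda>_. c)"
  by (rule sup_multiplierI[where B = "norm c" and C = "norm c"])
    (auto simp: fourier_R_cmult norm_mult intro: mult_left_mono)

lemma sup_multiplier_char: "sup_multiplier (\<lambda>x. exp (- (\<i> * complex_of_real (x \<bullet> \<eta>))))"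
  by (rule sup_multiplierI[where B = 1 and C = 1])
    (auto simp: fourier_R_char_mult intro!: continuous_intros)

lemma sup_multiplier_add:
  fixes p q :: "real ^ 'n \<Rightarrow> complex"
  assumes "sup_multiplier p" "sup_multiplier q"
  shows "sup_multiplier (\<lambda>x. p x + q x)"
proof -
  obtain B C where p: "continuous_on UNIV p" "\<And>x. norm (p x) \<le> B" "C \<ge> 0"
    "fourier_dominated C p"
    by (rule sup_multiplierE[OF assms(1)]) blast
  obtain B' C' where q: "continuous_on UNIV q" "\<And>x. norm (q x) \<le> B'" "C' \<ge> 0"
    "fourier_dominated C' q"
    by (rule sup_multiplierE[OF assms(2)]) blast
  show ?thesis
  proof (rule sup_multiplierI[where B = "B + B'" and C = "C + C'"])
    show "continuous_on UNIV (\<lambda>x. p x + q x)" using p(1) q(1) by (intro continuous_intros)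
    show "norm (p x + q x) \<le> B + B'" for x
      using p(2)[of x] q(2)[of x] by (intro norm_triangle_le) simp
    show "C + C' \<ge> 0" using p(3) q(3) by simp
    fix f :: "real ^ 'n \<Rightarrow> complex" and M \<xi>
    assume f: "integrable lebesgue f" "\<And>\<xi>. norm (fourier_R f \<xi>) \<le> M"
    have "fourier_R (\<lambda>x. (p x + q x) * f x) \<xi> =
        fourier_R (\<lambda>x. p x * f x) \<xi> + fourier_R (\<lambda>x. q x * f x) \<xi>"
      unfolding distrib_right using assms f(1) by (intro fourier_R_add sup_multiplier_integrable)
    then show "norm (fourier_R (\<lambda>x. (p x + q x) * f x) \<xi>) \<le> (C + C') * M"
      using fourier_dominatedD[OF p(4) f] fourier_dominatedD[OF q(4) f] norm_triangle_mono unfolding distrib_right by fastforce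
  qed
qed

lemma sup_multiplier_mult:
  fixes p q :: "real ^ 'n \<Rightarrow> complex"
  assumes "sup_multiplier p" "sup_multiplier q"
  shows "sup_multiplier (\<lambda>x. p x * q x)"
proof -
  obtain B C where p: "continuous_on UNIV p" "\<And>x. norm (p x) \<le> B" "C \<ge> 0"
    "fourier_dominated C p"
    by (rule sup_multiplierE[OF assms(1)]) blast
  obtain B' C' where q: "continuous_on UNIV q" "\<And>x. norm (q x) \<le> B'" "C' \<ge> 0"
    "fourier_dominated C' q"
    by (rule sup_multiplierE[OF assms(2)]) blast
  show ?thesis
  proof (rule sup_multiplierI[where B = "B * B'" and C = "C * C'"])
    show "continuous_on UNIV (\<lambda>x. p x * q x)" using p(1) q(1) by (intro continuous_intros)
    show "norm (p x * q x) \<le> B * B'" for x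
      using p(2)[of x] q(2)[of x] unfolding norm_mult by (meson mult_mono norm_ge_zero order_trans)
    show "C * C' \<ge> 0" using p(3) q(3) by simp
    fix f :: "real ^ 'n \<Rightarrow> complex" and M \<xi>
    assume f: "integrable lebesgue f" "\<And>\<xi>. norm (fourier_R f \<xi>) \<le> M"
    from fourier_dominatedD[OF p(4) sup_multiplier_integrable[OF assms(2) f(1)] fourier_dominatedD[OF q(4) f]]
    show "norm (fourier_R (\<lambda>x. p x * q x * f x) \<xi>) \<le> C * C' * M"
      by (simp add: mult.assoc)
  qed
qed

lemma sup_multiplier_sum:
  assumes "\<And>i. i \<in> I \<Longrightarrow> sup_multiplier (q i)"
  shows "sup_multiplier (\<lambda>x. \<Sum>i\<in>I. q i x)"
  using assms
  by (induction I rule: infinite_finite_induct) (auto intro: sup_multiplier_add sup_multiplier_const)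

lemma sup_multiplier_sin: "sup_multiplier (\<lambda>x::real ^ 'n. complex_of_real (sin (x $ i / L)))"
proof -
  have in_axis: "x \<bullet> axis i c = x $ i * c" for x :: "real ^ 'n" and c
    by (simp add: inner_axis)
  have "sup_multiplier (\<lambda>x. (1 / (2 * \<i>)) * (exp (- (\<i> * complex_of_real (x \<bullet> axis i (- 1 / L)))) +
      (- 1) * exp (- (\<i> * complex_of_real (x \<bullet> axis i (1 / L))))))"
    by (intro sup_multiplier_mult sup_multiplier_add sup_multiplier_const sup_multiplier_char)
  also have "(\<lambda>x. (1 / (2 * \<i>)) * (exp (- (\<i> * complex_of_real (x \<bullet> axis i (- 1 / L)))) +
      (- 1) * exp (- (\<i> * complex_of_real (x \<bullet> axis i (1 / L)))))) =
      (\<lambda>x::real ^ 'n. complex_of_real (sin (x $ i / L)))"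
    unfolding sin_of_real[symmetric] sin_exp_eq in_axis by (simp add: fun_eq_iff)
  finally show ?thesis .
qed

text \<open>The substitution \<open>y\<^sub>i = sin (x\<^sub>i / L)\<close> turns polynomials in \<open>y\<close> into trigonometric polynomials in
  \<open>x\<close>. These are bounded on the whole space by the bound of the polynomial on the cube \<open>[-1, 1]\<^sup>n\<close>.\<close>

lemma sup_multiplier_real_polynomial_sin:
  fixes q :: "real ^ 'n \<Rightarrow> real"
  assumes "real_polynomial_function q"
  shows "sup_multiplier (\<lambda>x. complex_of_real (q (\<chi> i. sin (x $ i / L))))"
  using assms
proof induction
  case (linear h)
  interpret bounded_linear h by fact
  have "h y = (\<Sum>i\<in>UNIV. y $ i * h (axis i 1))" for y
  proof -
    have "h y = h (\<Sum>i\<in>UNIV. (y $ i) *\<^sub>R axis i 1)"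
      using basis_expansion[of y] by (simp add: scalar_mult_eq_scaleR)
    then show ?thesis by (simp add: sum scaleR)
  qed
  then have "complex_of_real (h (\<chi> i. sin (x $ i / L))) =
      (\<Sum>i\<in>UNIV. complex_of_real (sin (x $ i / L)) * complex_of_real (h (axis i 1)))" for x
    by (metis (no_types, lifting) of_real_mult of_real_sum sum.cong vec_lambda_beta)
  then show ?case
    by (simp only:) (intro sup_multiplier_sum sup_multiplier_mult sup_multiplier_sin sup_multiplier_const)
qed (simp_all add: sup_multiplier_const sup_multiplier_add sup_multiplier_mult)

lemma sup_multiplier_polynomial_sin:
  fixes p :: "real ^ 'n \<Rightarrow> complex"
  assumes "polynomial_function p"
  shows "sup_multiplier (\<lambda>x. p (\<chi> i. sin (x $ i / L)))"
proof -
  have "real_polynomial_function (Re \<circ> p)" "real_polynomial_function (Im \<circ> p)"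
    using assms bounded_linear_Re bounded_linear_Im unfolding polynomial_function_def by auto
  note * = this[THEN sup_multiplier_real_polynomial_sin, where L = L]
  have "sup_multiplier (\<lambda>x. complex_of_real ((Re \<circ> p) (\<chi> i. sin (x $ i / L))) +
      \<i> * complex_of_real ((Im \<circ> p) (\<chi> i. sin (x $ i / L))))"
    by (intro sup_multiplier_add sup_multiplier_mult sup_multiplier_const *)
  then show ?thesis by (simp add: complex_eq[symmetric])
qed

text \<open>The function \<open>cnj (sgn f)\<close> recovers the whole norm. It is measurable, hence an almost everywhere
  limit of continuous functions, which can be cut off to values in the unit disc.\<close>

lemma continuous_norming_function:
  fixes f :: "'a::euclidean_space \<Rightarrow> complex"
  assumes f: "integrable lebesgue f" and a: "a < (LINT x|lebesgue. norm (f x))"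
  shows "\<exists>g. continuous_on UNIV g \<and> (\<forall>x. norm (g x) \<le> 1) \<and> a < norm (LINT x|lebesgue. g x * f x)"
proof -
  define s where "s x = cnj (sgn (f x))" for x
  have fm [measurable]: "f \<in> borel_measurable lebesgue" using f by (rule borel_measurable_integrable)
  have [measurable]: "cnj \<in> borel_measurable borel"
    by (intro borel_measurable_continuous_onI continuous_intros)
  have sm [measurable]: "s \<in> borel_measurable lebesgue"
    unfolding s_def sgn_div_norm by measurable
  then have "s measurable_on UNIV"
    by (intro lebesgue_measurable_imp_measurable_on) auto
  then obtain N g where N: "negligible N" and g: "\<And>n. continuous_on UNIV (g n)"
    "\<And>x. x \<notin> N \<Longrightarrow> (\<lambda>n. g n x) \<longlonglongrightarrow> s x"
    unfolding measurable_on_def by auto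
  \<comment> \<open>The radial retraction to the unit disc.\<close>
  define r :: "complex \<Rightarrow> complex" where "r z = z / complex_of_real (max 1 (norm z))" for z
  have r_cont: "continuous_on A r" for A unfolding r_def
    by (intro continuous_intros) (smt (verit) of_real_eq_0_iff)
  have r_le: "norm (r z) \<le> 1" for z by (auto simp: r_def norm_divide max_def)
  have s_le: "norm (s x) \<le> 1" for x by (simp add: s_def norm_sgn)
  have r_s: "r (s x) = s x" for x using s_le[of x] by (simp add: r_def max_def)
  have rg: "continuous_on UNIV (\<lambda>x. r (g n x))" for n
    using continuous_on_compose2[OF r_cont[of UNIV] g(1)] by auto
  have rgm [measurable]: "(\<lambda>x. r (g n x)) \<in> borel_measurable lebesgue" for n
    by (rule continuous_imp_measurable_lebesgue[OF rg])
  have "(\<lambda>n. LINT x|lebesgue. r (g n x) * f x) \<longlonglongrightarrow> (LINT x|lebesgue. s x * f x)"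
  proof (rule integral_dominated_convergence[where w = "\<lambda>x. norm (f x)"])
    have "N \<in> null_sets lebesgue" using N by (simp add: negligible_iff_null_sets)
    then show "AE x in lebesgue. (\<lambda>n. r (g n x) * f x) \<longlonglongrightarrow> s x * f x"
    proof (rule AE_I')
      have "(\<lambda>n. r (g n x) * f x) \<longlonglongrightarrow> s x * f x" if "x \<notin> N" for x
      proof -
        have "isCont r (s x)" using r_cont[of UNIV] by (simp add: continuous_on_eq_continuous_at)
        from isCont_tendsto_compose[OF this g(2)[OF that]] show ?thesis
          unfolding r_s by (intro tendsto_mult tendsto_const)
      qed
      then show "{x \<in> space lebesgue. \<not> (\<lambda>n. r (g n x) * f x) \<longlonglongrightarrow> s x * f x} \<subseteq> N" by blast
    qed
    show "AE x in lebesgue. norm (r (g n x) * f x) \<le> norm (f x)" for n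
      using r_le by (simp add: norm_mult mult_left_le_one_le)
  qed (use f in auto)
  from tendsto_norm[OF this]
  have "(\<lambda>n. norm (LINT x|lebesgue. r (g n x) * f x)) \<longlonglongrightarrow> norm (LINT x|lebesgue. s x * f x)" .
  moreover have "norm (LINT x|lebesgue. s x * f x) = (LINT x|lebesgue. norm (f x))"
  proof -
    have "s x * f x = complex_of_real (norm (f x))" for x
      by (cases "f x = 0") (auto simp: s_def sgn_eq mult.commute complex_norm_square[symmetric] power2_eq_square)
    then show ?thesis by simp
  qed
  ultimately have "eventually (\<lambda>n. a < norm (LINT x|lebesgue. r (g n x) * f x)) sequentially"
    using a by (intro order_tendstoD(1)) auto
  then obtain n where "a < norm (LINT x|lebesgue. r (g n x) * f x)"
    using eventually_happens'[OF sequentially_bot] by blast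
  then show ?thesis using rg[of n] r_le by blast
qed

text \<open>Start from a continuous norming function \<open>g\<close>. On a large cube of side \<open>L \<pi>\<close> centred at the origin,
  \<open>x\<^sub>i = L arcsin (sin (x\<^sub>i / L))\<close>, so there \<open>g\<close> agrees with a continuous function of the numbers
  \<open>sin (x\<^sub>i / L)\<close>. This function makes sense for all \<open>x\<close>, is bounded by 1 everywhere, and by
  Weierstrass' theorem on \<open>[-1, 1]\<^sup>n\<close> is uniformly close to a polynomial in these sines. The
  approximation is uniform on the whole space, so the bound on \<open>q\<close> holds beyond the cube too. The
  losses amount to a quarter of the norm, and the division by \<open>9 / 8\<close> that restores the bound 1
  leaves more than half of it.\<close>

lemma sup_multiplier_norming:
  fixes f :: "real ^ 'n \<Rightarrow> complex"
  assumes f: "integrable lebesgue f"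
  shows "\<exists>q. sup_multiplier q \<and> (\<forall>x. norm (q x) \<le> 1) \<and>
    (LINT x|lebesgue. norm (f x)) / 2 \<le> norm (LINT x|lebesgue. q x * f x)"
proof -
  define I where "I = (LINT x|lebesgue. norm (f x))"
  have "I \<ge> 0" unfolding I_def by simp
  show ?thesis
  proof (cases "I = 0")
    case True
    then show ?thesis unfolding I_def
      by (intro exI[of _ "\<lambda>_. 0"]) (auto intro: sup_multiplier_const)
  next
    case False
    with \<open>I \<ge> 0\<close> have I: "I > 0" by simp
    then have "7 / 8 * I < (LINT x|lebesgue. norm (f x))" by (simp add: I_def)
    from continuous_norming_function[OF f this] obtain g where
      g: "continuous_on UNIV g" "\<And>x. norm (g x) \<le> 1" "7 / 8 * I < norm (LINT x|lebesgue. g x * f x)"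
      by blast
    define k where "k m y = g (\<chi> i. real (Suc m) * arcsin (y $ i))" for m and y :: "real ^ 'n"
    define S where "S = {y :: real ^ 'n. \<forall>i. - 1 \<le> y $ i \<and> y $ i \<le> 1}"
    have S: "compact S"
    proof -
      have "S = cbox (\<chi> i. - 1) (\<chi> i. 1)" by (auto simp: S_def mem_box_cart)
      then show ?thesis by simp
    qed
    have k: "continuous_on S (k m)" for m
      unfolding k_def
      by (rule continuous_on_compose2[OF g(1)])
        (auto simp: S_def intro!: continuous_intros)
    have sinS: "(\<chi> i. sin (x $ i / L)) \<in> S" for x :: "real ^ 'n" and L by (simp add: S_def)
    define G where "G m x = k m (\<chi> i. sin (x $ i / real (Suc m)))" for m x
    have G_cont: "continuous_on UNIV (G m)" for m
      unfolding G_def by (rule continuous_on_compose2[OF k]) (auto simp: sinS intro!: continuous_intros)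
    have G_le: "norm (G m x) \<le> 1" for m x unfolding G_def k_def by (rule g(2))
    have [measurable]: "G m \<in> borel_measurable lebesgue" "g \<in> borel_measurable lebesgue" for m
      using G_cont g(1) by (auto intro: continuous_imp_measurable_lebesgue)
    have fm [measurable]: "f \<in> borel_measurable lebesgue" using f by (rule borel_measurable_integrable)
    have G_lim: "(\<lambda>m. G m x) \<longlonglongrightarrow> g x" for x
    proof (rule tendsto_eventually)
      obtain m0 where m0: "norm x \<le> real m0" using real_arch_simple by blast
      have "G m x = g x" if "m \<ge> m0" for m
      proof -
        have "arcsin (sin (x $ i / real (Suc m))) = x $ i / real (Suc m)" for i
        proof (rule arcsin_sin)
          have "\<bar>x $ i\<bar> \<le> real (Suc m)" using component_le_norm_cart[of x i] m0 that by simp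
          then have "\<bar>x $ i / real (Suc m)\<bar> \<le> 1" by (simp add: abs_divide)
          then have "\<bar>x $ i / real (Suc m)\<bar> \<le> pi / 2" using pi_ge_two by linarith
          from abs_le_D1[OF this] abs_le_D2[OF this] show "- (pi / 2) \<le> x $ i / real (Suc m)" "x $ i / real (Suc m) \<le> pi / 2"
            by (simp_all only: minus_le_iff)
        qed
        then show ?thesis unfolding G_def k_def by (simp del: of_nat_Suc)
      qed
      then show "eventually (\<lambda>m. G m x = g x) sequentially" using eventually_sequentially by blast
    qed
    have "(\<lambda>m. LINT x|lebesgue. G m x * f x) \<longlonglongrightarrow> (LINT x|lebesgue. g x * f x)"
    proof (rule integral_dominated_convergence[where w = "\<lambda>x. norm (f x)"])
      show "AE x in lebesgue. (\<lambda>m. G m x * f x) \<longlonglongrightarrow> g x * f x"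
        using G_lim by (intro AE_I2 tendsto_mult tendsto_const)
      show "AE x in lebesgue. norm (G m x * f x) \<le> norm (f x)" for m
        using G_le by (simp add: norm_mult mult_left_le_one_le)
    qed (use f in auto)
    from order_tendstoD(1)[OF tendsto_norm[OF this] g(3)] obtain m where
      m: "7 / 8 * I < norm (LINT x|lebesgue. G m x * f x)"
      using eventually_happens'[OF sequentially_bot] by blast
    obtain p where p: "polynomial_function p" "\<And>y. y \<in> S \<Longrightarrow> norm (k m y - p y) < 1 / 8"
      using Stone_Weierstrass_polynomial_function[OF S k[of m], of "1 / 8"] by auto
    define q where "q x = p (\<chi> i. sin (x $ i / real (Suc m)))" for x
    have q: "sup_multiplier q" unfolding q_def by (rule sup_multiplier_polynomial_sin[OF p(1)])
    have qG: "norm (G m x - q x) \<le> 1 / 8" for x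
      unfolding G_def q_def using p(2)[OF sinS] by (auto intro: less_imp_le)
    have q_le: "norm (q x) \<le> 9 / 8" for x
      using qG[of x] G_le[of m x] norm_triangle_ineq2[of "q x" "G m x"] by (simp add: norm_minus_commute)
    have [measurable]: "q \<in> borel_measurable lebesgue"
      using q by (elim sup_multiplierE) (rule continuous_imp_measurable_lebesgue)
    have "norm (LINT x|lebesgue. (G m x - q x) * f x) \<le> 1 / 8 * I"
      unfolding I_def by (rule integrable_bounded_mult(2)[OF f _ qG]) measurable
    moreover have "(LINT x|lebesgue. (G m x - q x) * f x) =
        (LINT x|lebesgue. G m x * f x) - (LINT x|lebesgue. q x * f x)"
      unfolding left_diff_distrib
      by (intro Bochner_Integration.integral_diff integrable_bounded_mult(1)[OF f _ G_le]
          integrable_bounded_mult(1)[OF f _ q_le]) measurable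
    ultimately have "3 / 4 * I \<le> norm (LINT x|lebesgue. q x * f x)"
      using m norm_triangle_ineq2[of "LINT x|lebesgue. G m x * f x" "LINT x|lebesgue. q x * f x"] by simp
    then have "I / 2 \<le> norm (LINT x|lebesgue. (8 / 9 * q x) * f x)"
      using I by (simp add: mult.assoc norm_mult)
    moreover have "sup_multiplier (\<lambda>x. 8 / 9 * q x)"
      by (intro sup_multiplier_mult sup_multiplier_const q)
    moreover have "norm (8 / 9 * q x) \<le> 1" for x using q_le[of x] by (simp add: norm_mult)
    ultimately show ?thesis unfolding I_def by blast
  qed
qed

lemma fourier_R_0: "fourier_R f 0 = (LINT x|lebesgue. f x)"
  by (simp add: fourier_R_def)

lemma sup_multiplier_integral_le:
  assumes "fourier_dominated C q" "integrable lebesgue f" "\<And>\<xi>. norm (fourier_R f \<xi>) \<le> M"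
  shows "norm (LINT x|lebesgue. q x * f x) \<le> C * M"
  using fourier_dominatedD[OF assms, of 0] by (simp add: fourier_R_0)

text \<open>If the transform of \<open>h\<close> vanishes, so does \<open>\<integral> q h\<close> for every multiplier \<open>q\<close>, hence by the norming
  property the norm of \<open>h\<close>.\<close>

lemma fourier_R_inject:
  fixes f g :: "real ^ 'n \<Rightarrow> complex"
  assumes f: "integrable lebesgue f" and g: "integrable lebesgue g" and eq: "fourier_R f = fourier_R g"
  shows "AE x in lebesgue. f x = g x"
proof -
  define h where "h x = f x + (- 1) * g x" for x
  have h: "integrable lebesgue h" unfolding h_def using f g by simp
  have "fourier_R h \<xi> = 0" for \<xi>
    unfolding h_def using f g fourier_R_cmult[of "- 1" g \<xi>] by (subst fourier_R_add) (auto simp: eq)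
  then have "norm (fourier_R h \<xi>) \<le> 0" for \<xi> by simp
  moreover obtain q where q: "sup_multiplier q"
    "(LINT x|lebesgue. norm (h x)) / 2 \<le> norm (LINT x|lebesgue. q x * h x)"
    using sup_multiplier_norming[OF h] by blast
  obtain C where C: "fourier_dominated C q" using q(1) by (rule sup_multiplierE)
  ultimately have "(LINT x|lebesgue. norm (h x)) \<le> 0"
    using sup_multiplier_integral_le[OF C h, of 0] q(2) by simp
  then have "(LINT x|lebesgue. norm (h x)) = 0"
    by (intro antisym integral_nonneg_AE) auto
  then have "AE x in lebesgue. norm (h x) = 0"
    using h by (subst (asm) integral_nonneg_eq_0_iff_AE) auto
  then show ?thesis by eventually_elim (simp add: h_def)
qed


section \<open>Boundedness of the inverse transform\<close>

locale reflexive_fourier_space =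
  fixes Y :: "(real ^ 'n \<Rightarrow> complex) set"
  assumes Y: "Y \<subseteq> C0" "cfun.subspace Y" "reflexive Y sup_norm" "Y \<subseteq> FL1_R"
begin

text \<open>The choice of the preimage is unique and linear only almost everywhere, so linearity is
  always used under an integral.\<close>

definition inv_fourier :: "(real ^ 'n \<Rightarrow> complex) \<Rightarrow> real ^ 'n \<Rightarrow> complex" where
  "inv_fourier F = (SOME f. integrable lebesgue f \<and> fourier_R f = F)"

definition preimage_norm :: "(real ^ 'n \<Rightarrow> complex) \<Rightarrow> real" where
  "preimage_norm F = (LINT x|lebesgue. norm (inv_fourier F x))"

text \<open>The value 0 outside \<open>Y\<close> is the normalisation of functionals in \<open>dual\<close>.\<close>

definition pairing :: "(real ^ 'n \<Rightarrow> complex) \<Rightarrow> (real ^ 'n \<Rightarrow> complex) \<Rightarrow> complex" where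
  "pairing g F = (if F \<in> Y then LINT x|lebesgue. g x * inv_fourier F x else 0)"

lemma add_mem: "F \<in> Y \<Longrightarrow> G \<in> Y \<Longrightarrow> F + G \<in> Y"
  and scale_mem: "F \<in> Y \<Longrightarrow> cscale c F \<in> Y"
  using Y(2) by (auto intro: cfun.subspace_add cfun.subspace_scale)

lemma inv_fourier:
  assumes "F \<in> Y"
  shows "integrable lebesgue (inv_fourier F)" "fourier_R (inv_fourier F) = F"
proof -
  have "\<exists>f. integrable lebesgue f \<and> fourier_R f = F" using assms Y(4) unfolding FL1_R_def by blast
  from someI_ex[OF this] show "integrable lebesgue (inv_fourier F)" "fourier_R (inv_fourier F) = F"
    unfolding inv_fourier_def by blast+
qed

lemma inv_fourier_add:
  assumes "F \<in> Y" "G \<in> Y"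
  shows "AE x in lebesgue. inv_fourier (F + G) x = inv_fourier F x + inv_fourier G x"
  using assms
  by (intro fourier_R_inject) (auto simp: inv_fourier add_mem fourier_R_add fun_eq_iff)

lemma inv_fourier_scale:
  assumes "F \<in> Y"
  shows "AE x in lebesgue. inv_fourier (cscale c F) x = c * inv_fourier F x"
proof (rule fourier_R_inject)
  show "fourier_R (inv_fourier (cscale c F)) = fourier_R (\<lambda>x. c * inv_fourier F x)"
    unfolding inv_fourier(2)[OF scale_mem[OF assms]]
    by (simp add: fun_eq_iff fourier_R_cmult inv_fourier(2)[OF assms] cscale_def)
qed (use assms in \<open>auto simp: inv_fourier scale_mem\<close>)

lemma inv_fourier_measurable [measurable]: "F \<in> Y \<Longrightarrow> inv_fourier F \<in> borel_measurable lebesgue"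
  using inv_fourier(1) by (rule borel_measurable_integrable)

lemma preimage_norm_add:
  assumes "F \<in> Y" "G \<in> Y" shows "preimage_norm (F + G) \<le> preimage_norm F + preimage_norm G"
proof -
  have "preimage_norm (F + G) \<le> (LINT x|lebesgue. norm (inv_fourier F x) + norm (inv_fourier G x))"
    unfolding preimage_norm_def
  proof (rule integral_mono_AE)
    show "AE x in lebesgue. norm (inv_fourier (F + G) x) \<le> norm (inv_fourier F x) + norm (inv_fourier G x)"
      using inv_fourier_add[OF assms] by eventually_elim (simp add: norm_triangle_ineq)
  qed (use assms add_mem inv_fourier(1) in auto)
  then show ?thesis using assms inv_fourier(1) by (simp add: preimage_norm_def)
qed

lemma preimage_norm_scale:
  assumes "F \<in> Y" shows "preimage_norm (cscale c F) = norm c * preimage_norm F"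
proof -
  have "preimage_norm (cscale c F) = (LINT x|lebesgue. norm c * norm (inv_fourier F x))"
    unfolding preimage_norm_def
  proof (rule integral_cong_AE)
    show "AE x in lebesgue. norm (inv_fourier (cscale c F) x) = norm c * norm (inv_fourier F x)"
      using inv_fourier_scale[OF assms, of c] by eventually_elim (simp add: norm_mult)
  qed (use assms scale_mem inv_fourier_measurable in measurable)
  then show ?thesis by (simp add: preimage_norm_def)
qed

lemma pairing_le:
  assumes "g \<in> borel_measurable lebesgue" "\<And>x. norm (g x) \<le> 1" "F \<in> Y"
  shows "norm (pairing g F) \<le> preimage_norm F"
  using integrable_bounded_mult(2)[OF inv_fourier(1)[OF assms(3)] assms(1,2)] assms(3)
  by (simp add: pairing_def preimage_norm_def)

lemma pairing_in_dual:
  assumes g: "g \<in> borel_measurable lebesgue" "\<And>x. norm (g x) \<le> B"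
    and bound: "\<And>F. F \<in> Y \<Longrightarrow> norm (pairing g F) \<le> K * sup_norm F"
  shows "pairing g \<in> dual Y sup_norm"
proof (rule mem_dualI)
  have int: "integrable lebesgue (\<lambda>x. g x * inv_fourier F x)" if "F \<in> Y" for F
    using integrable_bounded_mult(1)[OF inv_fourier(1)[OF that] g] .
  note [measurable] = g(1)
  fix F G assume FG: "F \<in> Y" "G \<in> Y"
  have "(LINT x|lebesgue. g x * inv_fourier (F + G) x) =
      (LINT x|lebesgue. g x * inv_fourier F x + g x * inv_fourier G x)"
  proof (rule integral_cong_AE)
    show "AE x in lebesgue. g x * inv_fourier (F + G) x = g x * inv_fourier F x + g x * inv_fourier G x"
      using inv_fourier_add[OF FG] by eventually_elim (simp add: distrib_left)
  qed (use FG add_mem inv_fourier_measurable in measurable)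
  then show "pairing g (F + G) = pairing g F + pairing g G"
    using FG add_mem int by (simp add: pairing_def)
next
  note [measurable] = g(1)
  fix c F assume F: "F \<in> Y"
  have "(LINT x|lebesgue. g x * inv_fourier (cscale c F) x) =
      (LINT x|lebesgue. c * (g x * inv_fourier F x))"
  proof (rule integral_cong_AE)
    show "AE x in lebesgue. g x * inv_fourier (cscale c F) x = c * (g x * inv_fourier F x)"
      using inv_fourier_scale[OF F, of c] by eventually_elim simp
  qed (use F scale_mem inv_fourier_measurable in measurable)
  then show "pairing g (cscale c F) = c * pairing g F"
    using F scale_mem by (simp add: pairing_def)
next
  show "norm (pairing g F) \<le> K * sup_norm F" if "F \<in> Y" for F using bound[OF that] .
qed (simp add: pairing_def)

lemma pairing_sup_multiplier_le:
  assumes "fourier_dominated C q" "F \<in> Y" "\<And>\<xi>. norm (F \<xi>) \<le> M"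
  shows "norm (pairing q F) \<le> C * M"
  using sup_multiplier_integral_le[OF assms(1) inv_fourier(1)[OF assms(2)], of M] assms(2,3)
  by (simp add: pairing_def inv_fourier(2))

lemma pairing_sup_multiplier_in_dual:
  assumes "sup_multiplier q"
  shows "pairing q \<in> dual Y sup_norm"
proof -
  obtain B C where q: "continuous_on UNIV q" "\<And>x. norm (q x) \<le> B" "fourier_dominated C q"
    by (rule sup_multiplierE[OF assms]) blast
  show ?thesis
  proof (rule pairing_in_dual)
    show "q \<in> borel_measurable lebesgue" by (rule continuous_imp_measurable_lebesgue[OF q(1)])
    show "norm (pairing q F) \<le> C * sup_norm F" if "F \<in> Y" for F
      using that Y(1) by (intro pairing_sup_multiplier_le[OF q(3)]) (auto intro: norm_le_sup_norm)
  qed (rule q(2))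
qed

text \<open>The step of the construction behind the uniform boundedness principle. If preimages of the unit
  ball are unbounded, some small \<open>D\<close> has a preimage of norm more than \<open>4 a\<close>; since \<open>2 D\<close> is the
  difference of \<open>F + D\<close> and \<open>F - D\<close>, one of these two functions \<open>F'\<close> also has one. A multiplier \<open>q\<close> detects
  half of this norm, and by continuity still a quarter of it within distance \<open>2 r'\<close> of \<open>F'\<close>.\<close>

lemma large_preimage_norm_nearby:
  assumes unbounded: "\<And>B. \<exists>F\<in>Y. (\<forall>\<xi>. norm (F \<xi>) \<le> 1) \<and> B < preimage_norm F"
    and F: "F \<in> Y" and r: "r > 0" and a: "a > 0"
  shows "\<exists>F'\<in>Y. \<exists>r'>0. \<exists>q C. (\<forall>\<xi>. norm (F' \<xi> - F \<xi>) \<le> r) \<and> 2 * r' \<le> r \<and>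
     sup_multiplier q \<and> (\<forall>x. norm (q x) \<le> 1) \<and> fourier_dominated C q \<and>
     C * (2 * r') \<le> a \<and> 2 * a < norm (pairing q F')"
proof -
  obtain E where E: "E \<in> Y" "\<And>\<xi>. norm (E \<xi>) \<le> 1" "4 * a / r < preimage_norm E"
    using unbounded[of "4 * a / r"] by blast
  define D where "D = cscale (complex_of_real r) E"
  have D: "D \<in> Y" "\<And>\<xi>. norm (D \<xi>) \<le> r" "4 * a < preimage_norm D"
    using E r by (auto simp: D_def scale_mem preimage_norm_scale field_simps)
      (simp add: cscale_def norm_mult)
  define D' where "D' = cscale (- 1) D"
  have D': "D' \<in> Y" "\<And>\<xi>. norm (D' \<xi>) \<le> r"
    unfolding D'_def by (rule scale_mem[OF D(1)]) (use D(2) in \<open>simp add: cscale_def\<close>)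
  have "\<exists>F'\<in>Y. (\<forall>\<xi>. norm (F' \<xi> - F \<xi>) \<le> r) \<and> 4 * a < preimage_norm F'"
  proof (rule ccontr)
    assume neg: "\<not> ?thesis"
    have "preimage_norm (F + G) \<le> 4 * a" if "G \<in> Y" "\<And>\<xi>. norm (G \<xi>) \<le> r" for G
    proof (rule ccontr)
      assume "\<not> ?thesis"
      moreover have "norm ((F + G) \<xi> - F \<xi>) \<le> r" for \<xi> using that(2) by simp
      ultimately show False using neg add_mem[OF F that(1)] by (metis not_le)
    qed
    from this[OF D(1,2)] this[OF D'] have "preimage_norm (F + D) \<le> 4 * a" "preimage_norm (F + D') \<le> 4 * a" .
    moreover have "2 * preimage_norm D \<le> preimage_norm (F + D) + preimage_norm (F + D')"
    proof -
      have mem: "F + D \<in> Y" "F + D' \<in> Y" using F D(1) D'(1) by (simp_all only: add_mem)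
      have "2 * preimage_norm D = preimage_norm (cscale 2 D)" by (simp only: preimage_norm_scale[OF D(1)]) simp
      also have "cscale 2 D = (F + D) + cscale (- 1) (F + D')"
        by (auto simp: cscale_def D'_def fun_eq_iff)
      also have "preimage_norm \<dots> \<le> preimage_norm (F + D) + preimage_norm (cscale (- 1) (F + D'))"
        by (rule preimage_norm_add[OF mem(1) scale_mem[OF mem(2)]])
      also have "\<dots> = preimage_norm (F + D) + preimage_norm (F + D')"
        by (simp only: preimage_norm_scale[OF mem(2)]) simp
      finally show ?thesis .
    qed
    ultimately show False using D(3) by simp
  qed
  then obtain F' where F': "F' \<in> Y" "\<And>\<xi>. norm (F' \<xi> - F \<xi>) \<le> r" "4 * a < preimage_norm F'" by blast
  obtain q where q: "sup_multiplier q" "\<forall>x. norm (q x) \<le> 1" "preimage_norm F' / 2 \<le> norm (pairing q F')"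
    using sup_multiplier_norming[OF inv_fourier(1)[OF F'(1)]] F'(1) unfolding preimage_norm_def pairing_def by auto
  obtain C where C: "C \<ge> 0" "fourier_dominated C q" using q(1) by (rule sup_multiplierE)
  define t where "t = a / (C + 1)"
  define r' where "r' = min (r / 2) (t / 2)"
  have t: "t > 0" "C * t \<le> a" using a C(1) by (auto simp: t_def field_simps)
  have r': "r' > 0" "2 * r' \<le> r" "2 * r' \<le> t" using r t(1) by (auto simp: r'_def)
  have "C * (2 * r') \<le> C * t" using C(1) r'(3) by (rule mult_left_mono[rotated])
  also have "\<dots> \<le> a" by (rule t(2))
  finally show ?thesis using F' q C(2) r' by (intro bexI[of _ F'] exI[of _ r'] conjI exI[of _ q] exI[of _ C]) auto
qed

text \<open>Iterating the step gives a Cauchy sequence in \<open>Y\<close>. Its weak limit \<open>H\<close> is tested by all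
  the multipliers found on the way, so that the preimage of \<open>H\<close> would have infinite norm.\<close>

lemma inv_fourier_bounded:
  "\<exists>B. \<forall>F\<in>Y. (\<forall>\<xi>. norm (F \<xi>) \<le> 1) \<longrightarrow> preimage_norm F \<le> B"
proof (rule ccontr)
  assume "\<not> ?thesis"
  then have unbounded: "\<exists>F\<in>Y. (\<forall>\<xi>. norm (F \<xi>) \<le> 1) \<and> B < preimage_norm F" for B
    by (auto simp: not_le)
  define good where "good n F' r' \<longleftrightarrow> (\<exists>q C. sup_multiplier q \<and> (\<forall>x. norm (q x) \<le> 1) \<and>
      fourier_dominated C q \<and> C * (2 * r') \<le> real (Suc n) \<and> 2 * real (Suc n) < norm (pairing q F'))"
    for n and F' :: "real ^ 'n \<Rightarrow> complex" and r'
  have "\<exists>s. \<forall>n. (fst (s n) \<in> Y \<and> snd (s n) > 0) \<and>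
     (\<forall>\<xi>. norm (fst (s (Suc n)) \<xi> - fst (s n) \<xi>) \<le> snd (s n)) \<and> 2 * snd (s (Suc n)) \<le> snd (s n) \<and>
     good n (fst (s (Suc n))) (snd (s (Suc n)))"
  proof (rule dependent_nat_choice)
    have "0 \<in> Y" by (rule cfun.subspace_0[OF Y(2)])
    then show "\<exists>x. fst x \<in> Y \<and> snd x > (0::real)" by (intro exI[of _ "(0, 1)"]) (simp only: fst_conv snd_conv, simp)
    fix x :: "(real ^ 'n \<Rightarrow> complex) \<times> real" and n
    assume "fst x \<in> Y \<and> snd x > 0"
    then obtain F' r' where "F' \<in> Y" "r' > 0" "\<forall>\<xi>. norm (F' \<xi> - fst x \<xi>) \<le> snd x" "2 * r' \<le> snd x" "good n F' r'"
      using large_preimage_norm_nearby[OF unbounded, of "fst x" "snd x" "real (Suc n)"] unfolding good_def by auto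
    then show "\<exists>y. (fst y \<in> Y \<and> snd y > 0) \<and> (\<forall>\<xi>. norm (fst y \<xi> - fst x \<xi>) \<le> snd x) \<and>
        2 * snd y \<le> snd x \<and> good n (fst y) (snd y)"
      by (intro exI[of _ "(F', r')"]) simp
  qed
  then obtain s where s: "\<forall>n. (fst (s n) \<in> Y \<and> snd (s n) > 0) \<and>
     (\<forall>\<xi>. norm (fst (s (Suc n)) \<xi> - fst (s n) \<xi>) \<le> snd (s n)) \<and> 2 * snd (s (Suc n)) \<le> snd (s n) \<and>
     good n (fst (s (Suc n))) (snd (s (Suc n)))" by blast
  define F r where "F n = fst (s n)" and "r n = snd (s n)" for n
  have F: "F n \<in> Y" and r: "r n > 0" and step: "norm (F (Suc n) \<xi> - F n \<xi>) \<le> r n"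
    and r_half: "2 * r (Suc n) \<le> r n" and good: "good n (F (Suc n)) (r (Suc n))" for n \<xi>
    using s unfolding F_def r_def by blast+
  \<comment> \<open>The steps are bounded by radii that halve each time; the negative term makes the induction work.\<close>
  have cauchy: "norm (F (n + d) \<xi> - F n \<xi>) \<le> 2 * r n - 2 * r (n + d)" for n d \<xi>
  proof (induction d)
    case (Suc d)
    have "norm (F (n + Suc d) \<xi> - F n \<xi>) \<le>
        norm (F (Suc (n + d)) \<xi> - F (n + d) \<xi>) + norm (F (n + d) \<xi> - F n \<xi>)"
      using norm_triangle_ineq[of "F (Suc (n + d)) \<xi> - F (n + d) \<xi>" "F (n + d) \<xi> - F n \<xi>"] by simp
    then show ?case using Suc step[of "n + d" \<xi>] r_half[of "n + d"] by simp
  qed simp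
  have close: "norm (F m \<xi> - F n \<xi>) \<le> 2 * r n" if "n \<le> m" for m n \<xi>
    using cauchy[of n "m - n" \<xi>] r[of m] that by simp
  have bounded: "norm (F m \<xi>) \<le> sup_norm (F 0) + 2 * r 0" for m \<xi>
    using close[of 0 m \<xi>] norm_le_sup_norm[of "F 0" \<xi>] F[of 0] Y(1)
      norm_triangle_ineq2[of "F m \<xi>" "F 0 \<xi>"] by fastforce
  obtain H where H: "H \<in> Y" "\<And>\<phi>. \<phi> \<in> dual Y sup_norm \<Longrightarrow> ((\<lambda>m. \<phi> (F m)) \<longlongrightarrow> \<phi> H) free_filter"
    using reflexive_weak_limit[of Y F, OF Y(1-3) F bounded] by blast
  have large: "real (Suc n) \<le> preimage_norm H" for n
  proof -
    obtain q C where q: "sup_multiplier q" "\<And>x. norm (q x) \<le> 1" "fourier_dominated C q"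
      "C * (2 * r (Suc n)) \<le> real (Suc n)" "2 * real (Suc n) < norm (pairing q (F (Suc n)))"
      using good[of n] unfolding good_def by blast
    have dual: "pairing q \<in> dual Y sup_norm" by (rule pairing_sup_multiplier_in_dual[OF q(1)])
    have "real (Suc n) \<le> norm (pairing q (F m))" if "Suc n \<le> m" for m
    proof -
      define E where "E = F m + cscale (- 1) (F (Suc n))"
      have E: "E \<in> Y" unfolding E_def by (intro add_mem scale_mem F)
      have "norm (E \<xi>) \<le> 2 * r (Suc n)" for \<xi> using close[OF that, of \<xi>] by (simp add: E_def cscale_def)
      from pairing_sup_multiplier_le[OF q(3) E this]
      have "norm (pairing q E) \<le> real (Suc n)" using q(4) by simp
      moreover have "pairing q E = pairing q (F m) - pairing q (F (Suc n))"
      proof -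
        have "pairing q E = pairing q (F m) + pairing q (cscale (- 1) (F (Suc n)))"
          using dual F[of m] scale_mem[OF F[of "Suc n"], of "- 1"] unfolding E_def dual_def by blast
        moreover have "pairing q (cscale (- 1) (F (Suc n))) = (- 1) * pairing q (F (Suc n))"
          using dual F[of "Suc n"] unfolding dual_def by blast
        ultimately show ?thesis by simp
      qed
      ultimately show ?thesis
        using q(5) norm_triangle_ineq2[of "pairing q (F (Suc n))" "pairing q (F m)"]
        by (simp add: norm_minus_commute)
    qed
    then have "real (Suc n) \<le> norm (pairing q H)"
      by (rule norm_free_filter_limit_ge[OF H(2)[OF dual]])
    also have "\<dots> \<le> preimage_norm H"
    proof (rule pairing_le[OF _ q(2) H(1)])
      show "q \<in> borel_measurable lebesgue"
        using q(1) by (rule sup_multiplierE) (rule continuous_imp_measurable_lebesgue)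
    qed
    finally show ?thesis .
  qed
  obtain n where "preimage_norm H < real n" using reals_Archimedean2 by blast
  then show False using large[of n] by simp
qed

lemma preimage_norm_le_sup_norm:
  "\<exists>B>0. \<forall>F\<in>Y. preimage_norm F \<le> B * sup_norm F"
proof -
  obtain B0 where B0: "\<forall>F\<in>Y. (\<forall>\<xi>. norm (F \<xi>) \<le> 1) \<longrightarrow> preimage_norm F \<le> B0"
    using inv_fourier_bounded by blast
  define B where "B = max B0 1"
  have "preimage_norm F \<le> B * sup_norm F" if F: "F \<in> Y" for F
  proof -
    have le: "norm (F \<xi>) \<le> sup_norm F" for \<xi> using F Y(1) by (auto intro: norm_le_sup_norm)
    have nn: "0 \<le> sup_norm F" using le[of undefined] norm_ge_zero order_trans by blast
    have "preimage_norm F \<le> B * t" if t: "t > sup_norm F" for t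
    proof -
      have "t > 0" using t nn by simp
      let ?G = "cscale (1 / complex_of_real t) F"
      have "norm (?G \<xi>) \<le> 1" for \<xi>
        using le[of \<xi>] t \<open>t > 0\<close> by (simp add: cscale_def norm_mult norm_divide)
      then have "preimage_norm ?G \<le> B" using B0 scale_mem[OF F] unfolding B_def by fastforce
      then show ?thesis using preimage_norm_scale[OF F] \<open>t > 0\<close> by (simp add: norm_divide field_simps)
    qed
    moreover have "B > 0" by (simp add: B_def)
    ultimately have "preimage_norm F / B \<le> t" if "t > sup_norm F" for t
      using that by (simp add: pos_divide_le_eq mult.commute[of t B])
    then have "preimage_norm F / B \<le> sup_norm F" by (rule dense_ge)
    then show ?thesis using \<open>B > 0\<close> by (simp add: field_simps)
  qed
  moreover have "B > 0" by (simp add: B_def)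
  ultimately show ?thesis by blast
qed

end

section \<open>Uniform tightness\<close>

lemma norm_gt_measurable [measurable]: "{x::real ^ 'n. R < norm x} \<in> sets lebesgue"
proof -
  have "open {x::real ^ 'n. R < norm x}" by (intro open_Collect_less continuous_intros)
  then show ?thesis by (simp add: borel_open)
qed

text \<open>The function that on the annulus \<open>\<rho> k < \<bar>x\<bar> \<le> \<rho> (Suc k)\<close> is the conjugate sign of \<open>f k\<close>, cut
  off to the annuli with \<open>k \<ge> m\<close>: a single test function for all \<open>f k\<close> with \<open>k \<ge> m\<close>.\<close>

lemma annulus_test_function:
  fixes f :: "nat \<Rightarrow> real ^ 'n \<Rightarrow> complex" and \<rho> :: "nat \<Rightarrow> nat"
  assumes f [measurable]: "\<And>k. f k \<in> borel_measurable lebesgue" and \<rho>: "strict_mono \<rho>"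
  shows "\<exists>g. g \<in> borel_measurable lebesgue \<and> (\<forall>x. norm (g x) \<le> 1) \<and>
    (\<forall>x. norm x \<le> real (\<rho> m) \<longrightarrow> g x = 0) \<and>
    (\<forall>k\<ge>m. \<forall>x. real (\<rho> k) < norm x \<longrightarrow> norm x \<le> real (\<rho> (Suc k)) \<longrightarrow> g x * f k x = of_real (norm (f k x)))"
proof -
  \<comment> \<open>The index of the annulus that contains \<open>x\<close>.\<close>
  define \<kappa> where "\<kappa> x = (LEAST k. norm x \<le> real (\<rho> (Suc k)))" for x :: "real ^ 'n"
  define g where "g x = indicator {x. real (\<rho> m) < norm x} x * cnj (sgn (f (\<kappa> x) x))" for x
  have \<kappa>: "\<kappa> x = k" if "real (\<rho> k) < norm x" "norm x \<le> real (\<rho> (Suc k))" for x k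
    unfolding \<kappa>_def
  proof (rule Least_equality)
    fix j assume "norm x \<le> real (\<rho> (Suc j))"
    then have "\<rho> k < \<rho> (Suc j)" using that(1) by simp
    then show "k \<le> j" using \<rho> by (simp add: strict_mono_less)
  qed (rule that(2))
  have [measurable]: "cnj \<in> borel_measurable borel"
    by (intro borel_measurable_continuous_onI continuous_intros)
  have [measurable]: "(\<lambda>x::real ^ 'n. x) \<in> borel_measurable lebesgue"
    by (simp add: measurable_completion)
  have [measurable]: "\<kappa> \<in> measurable lebesgue (count_space UNIV)"
    unfolding \<kappa>_def by measurable
  have "(\<lambda>x. cnj (sgn (f (\<kappa> x) x))) \<in> borel_measurable lebesgue"
  proof (rule measurable_compose_countable[where g = \<kappa>])
    show "(\<lambda>x. cnj (sgn (f i x))) \<in> borel_measurable lebesgue" for i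
      unfolding sgn_div_norm by measurable
  qed measurable
  then have "g \<in> borel_measurable lebesgue" unfolding g_def by measurable
  moreover have "norm (g x) \<le> 1" for x by (auto simp: g_def indicator_def norm_sgn)
  moreover have "g x = 0" if "norm x \<le> real (\<rho> m)" for x using that by (simp add: g_def)
  moreover have "g x * f k x = of_real (norm (f k x))"
    if "m \<le> k" "real (\<rho> k) < norm x" "norm x \<le> real (\<rho> (Suc k))" for k x
  proof -
    have "\<rho> m \<le> \<rho> k" using \<rho> that(1) by (simp add: strict_mono_less_eq)
    then have "real (\<rho> m) < norm x" using that(2) by simp
    then have "g x = cnj (sgn (f k x))" using \<kappa>[OF that(2,3)] by (simp add: g_def)
    then show ?thesis
      by (cases "f k x = 0") (auto simp: sgn_eq mult.commute complex_norm_square[symmetric] power2_eq_square)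
  qed
  ultimately show ?thesis by blast
qed

context reflexive_fourier_space
begin

definition tail :: "real \<Rightarrow> (real ^ 'n \<Rightarrow> complex) \<Rightarrow> real" where
  "tail R F = (LINT x|lebesgue. indicator {x. R < norm x} x * norm (inv_fourier F x))"

lemma tail_integrable:
  assumes "F \<in> Y"
  shows "integrable lebesgue (\<lambda>x. indicator {x. R < norm x} x * norm (inv_fourier F x))"
proof (rule Bochner_Integration.integrable_bound[OF integrable_norm[OF inv_fourier(1)[OF assms]]])
  show "(\<lambda>x. indicator {x. R < norm x} x * norm (inv_fourier F x)) \<in> borel_measurable lebesgue"
    using inv_fourier_measurable[OF assms] by measurable
qed (auto simp: indicator_def)

lemma tail_le_preimage_norm: "F \<in> Y \<Longrightarrow> tail R F \<le> preimage_norm F"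
  unfolding tail_def preimage_norm_def
  by (intro integral_mono tail_integrable integrable_norm inv_fourier(1)) (auto simp: indicator_def)

lemma tail_tendsto_0:
  assumes F: "F \<in> Y"
  shows "(\<lambda>n. tail (real n) F) \<longlonglongrightarrow> 0"
proof -
  note [measurable] = inv_fourier_measurable[OF F]
  have "(\<lambda>n. tail (real n) F) \<longlonglongrightarrow> (LINT x|(lebesgue :: (real ^ 'n) measure). 0)"
    unfolding tail_def
  proof (rule integral_dominated_convergence[where w = "\<lambda>x. norm (inv_fourier F x)"])
    show "AE x in lebesgue. (\<lambda>n. indicator {x. real n < norm x} x * norm (inv_fourier F x)) \<longlonglongrightarrow> 0"
    proof (intro AE_I2 tendsto_eventually)
      fix x :: "real ^ 'n"
      obtain m where "norm x \<le> real m" using real_arch_simple by blast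
      then show "eventually (\<lambda>n. indicator {x. real n < norm x} x * norm (inv_fourier F x) = 0) sequentially"
        by (intro eventually_sequentiallyI[of m]) (auto simp: indicator_def)
    qed
    show "AE x in lebesgue. norm (indicator {x. real n < norm x} x * norm (inv_fourier F x)) \<le> norm (inv_fourier F x)" for n
      by (auto simp: indicator_def)
  qed (use inv_fourier(1)[OF F] in auto)
  then show ?thesis by simp
qed

lemma pairing_le_tail:
  assumes g: "g \<in> borel_measurable lebesgue" "\<And>x. norm (g x) \<le> 1" "\<And>x. norm x \<le> R \<Longrightarrow> g x = 0"
    and F: "F \<in> Y"
  shows "norm (pairing g F) \<le> tail R F"
proof -
  have "norm (pairing g F) \<le> (LINT x|lebesgue. norm (g x * inv_fourier F x))"
    using F by (simp add: pairing_def)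
  also have "\<dots> \<le> tail R F"
    unfolding tail_def
  proof (rule integral_mono)
    show "norm (g x * inv_fourier F x) \<le> indicator {x. R < norm x} x * norm (inv_fourier F x)" for x
      using g(2)[of x] g(3)[of x] by (auto simp: indicator_def norm_mult mult_left_le_one_le)
    show "integrable lebesgue (\<lambda>x. norm (g x * inv_fourier F x))"
      using integrable_bounded_mult(1)[OF inv_fourier(1)[OF F] g(1,2)] by simp
  qed (rule tail_integrable[OF F])
  finally show ?thesis .
qed

text \<open>Let \<open>\<eta>\<close> be the largest mass that functions of the unit ball can carry arbitrarily far away. By the
  choice of \<open>\<eta>\<close> there is a radius \<open>R0\<close> beyond which no preimage has mass more than \<open>9 / 8 \<eta>\<close>, while
  beyond every radius some preimage has mass more than \<open>7 / 8 \<eta>\<close>. Hence preimages \<open>f\<^sub>k\<close> can be found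
  with mass at least \<open>7 / 8 \<eta> - 1 / 8 \<eta> = 3 / 4 \<eta>\<close> on the \<open>k\<close>-th of a sequence of disjoint annuli beyond
  \<open>R0\<close>. By the choice of \<open>R0\<close>, at most \<open>3 / 8 \<eta>\<close> is left for the rest of the exterior of
  \<open>R0\<close>, including the other annuli. The test function of the annuli from the \<open>m\<close>-th on
  therefore has integral at least \<open>3 / 4 \<eta> - 3 / 8 \<eta>\<close> against \<open>f\<^sub>k\<close> for all \<open>k \<ge> m\<close>, hence also
  against the preimage of a weak limit. Since \<open>m\<close> is arbitrary, the tails of that preimage do
  not tend to zero.\<close>

lemma tail_uniformly_small:
  assumes "\<delta> > 0"
  shows "\<exists>R::nat. \<forall>F\<in>Y. (\<forall>\<xi>. norm (F \<xi>) \<le> 1) \<longrightarrow> tail (real R) F \<le> \<delta>"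
proof (rule ccontr)
  assume neg: "\<not> ?thesis"
  define ball where "ball = {F \<in> Y. \<forall>\<xi>. norm (F \<xi>) \<le> 1}"
  have ballY: "F \<in> Y" if "F \<in> ball" for F using that by (simp add: ball_def)
  obtain B where B: "\<And>F. F \<in> ball \<Longrightarrow> preimage_norm F \<le> B"
    using inv_fourier_bounded unfolding ball_def by auto
  define D where "D = {d. \<forall>R::nat. \<exists>F\<in>ball. d < tail (real R) F}"
  define \<eta> where "\<eta> = Sup D"
  have \<delta>D: "\<delta> \<in> D" using neg unfolding D_def ball_def by (auto simp: not_le)
  have bdd: "bdd_above D"
  proof (rule bdd_aboveI)
    fix d assume "d \<in> D"
    then obtain F where F: "F \<in> ball" "d < tail (real 0) F" unfolding D_def by blast
    then show "d \<le> B" using tail_le_preimage_norm[OF ballY[OF F(1)], of "real 0"] B[OF F(1)] by linarith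
  qed
  have \<eta>: "\<eta> > 0" using cSup_upper[OF \<delta>D bdd] assms by (simp add: \<eta>_def)
  then have "7 / 8 * \<eta> < Sup D" by (simp add: \<eta>_def)
  then obtain d where d: "d \<in> D" "7 / 8 * \<eta> < d" using \<delta>D bdd by (subst (asm) less_cSup_iff) auto
  then have escape: "\<exists>F\<in>ball. 7 / 8 * \<eta> < tail (real R) F" for R :: nat
    unfolding D_def by (blast intro: less_trans)
  have "9 / 8 * \<eta> \<notin> D" using cSup_upper[OF _ bdd, of "9 / 8 * \<eta>"] \<eta> by (auto simp: \<eta>_def)
  then obtain R0 :: nat where R0: "\<And>F. F \<in> ball \<Longrightarrow> tail (real R0) F \<le> 9 / 8 * \<eta>"
    unfolding D_def by (force simp: not_less)
  obtain E where E: "\<And>R::nat. E R \<in> ball" "\<And>R::nat. 7 / 8 * \<eta> < tail (real R) (E R)"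
    using escape by metis
  have "\<exists>R'>R. tail (real R') (E R) < 1 / 8 * \<eta>" for R :: nat
  proof -
    have "eventually (\<lambda>n. tail (real n) (E R) < 1 / 8 * \<eta>) sequentially"
      using tail_tendsto_0[OF ballY[OF E(1)]] \<eta> by (intro order_tendstoD(2)) auto
    then obtain n where "\<And>m. m \<ge> n \<Longrightarrow> tail (real m) (E R) < 1 / 8 * \<eta>"
      unfolding eventually_sequentially by blast
    then show ?thesis by (intro exI[of _ "max n (Suc R)"]) auto
  qed
  then obtain nx where nx: "\<And>R::nat. nx R > R" "\<And>R. tail (real (nx R)) (E R) < 1 / 8 * \<eta>"
    by metis
  define \<rho> where "\<rho> k = (nx ^^ k) R0" for k
  have \<rho>_Suc: "\<rho> (Suc k) = nx (\<rho> k)" and \<rho>0: "\<rho> 0 = R0" for k by (simp_all add: \<rho>_def)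
  have \<rho>: "strict_mono \<rho>" using nx(1) by (simp add: strict_mono_Suc_iff \<rho>_Suc)
  define F where "F k = E (\<rho> k)" for k
  have F: "F k \<in> ball" "F k \<in> Y" for k using E(1) ballY by (simp_all add: F_def)
  have F1: "norm (F k \<xi>) \<le> 1" for k \<xi> using F(1)[of k] by (simp add: ball_def)
  obtain H where H: "H \<in> Y" "\<And>\<phi>. \<phi> \<in> dual Y sup_norm \<Longrightarrow> ((\<lambda>m. \<phi> (F m)) \<longlongrightarrow> \<phi> H) free_filter"
    using reflexive_weak_limit[of Y F 1, OF Y(1-3) F(2) F1] by blast
  have "3 / 8 * \<eta> \<le> tail (real m) H" for m
  proof -
    have "\<exists>g. g \<in> borel_measurable lebesgue \<and> (\<forall>x. norm (g x) \<le> 1) \<and>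
      (\<forall>x. norm x \<le> real (\<rho> m) \<longrightarrow> g x = 0) \<and>
      (\<forall>k\<ge>m. \<forall>x. real (\<rho> k) < norm x \<longrightarrow> norm x \<le> real (\<rho> (Suc k)) \<longrightarrow>
         g x * inv_fourier (F k) x = of_real (norm (inv_fourier (F k) x)))"
      using F(2) by (intro annulus_test_function \<rho>) measurable
    then obtain g where g: "g \<in> borel_measurable lebesgue" "\<And>x. norm (g x) \<le> 1"
      "\<And>x. norm x \<le> real (\<rho> m) \<Longrightarrow> g x = 0"
      "\<And>k x. m \<le> k \<Longrightarrow> real (\<rho> k) < norm x \<Longrightarrow> norm x \<le> real (\<rho> (Suc k)) \<Longrightarrow>
         g x * inv_fourier (F k) x = of_real (norm (inv_fourier (F k) x))"
      by blast
    obtain B' where "\<And>F. F \<in> Y \<Longrightarrow> preimage_norm F \<le> B' * sup_norm F" using preimage_norm_le_sup_norm by blast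
    then have dual: "pairing g \<in> dual Y sup_norm"
      using pairing_le[OF g(1,2)] by (intro pairing_in_dual[OF g(1,2)]) (blast intro: order_trans)
    have "3 / 8 * \<eta> \<le> norm (pairing g (F k))" if k: "m \<le> k" for k
    proof -
      define h where "h x = norm (inv_fourier (F k) x)" for x
      let ?i = "\<lambda>R x. indicator {x. real R < norm x} x * h x"
      have int: "integrable lebesgue (?i R)" for R
        unfolding h_def by (rule tail_integrable[OF F(2)])
      have tail: "(LINT x|lebesgue. ?i R x) = tail (real R) (F k)" for R by (simp add: tail_def h_def)
      have intg: "integrable lebesgue (\<lambda>x. g x * inv_fourier (F k) x)"
        by (rule integrable_bounded_mult(1)[OF inv_fourier(1)[OF F(2)] g(1,2)])
      have "R0 \<le> \<rho> k" "R0 \<le> \<rho> m" "\<rho> k < \<rho> (Suc k)"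
        using strict_mono_less_eq[OF \<rho>, of 0] strict_mono_less[OF \<rho>] \<rho>0 by auto
      \<comment> \<open>The integrand is \<open>h\<close> on the \<open>k\<close>-th annulus, at least \<open>- h\<close> elsewhere beyond \<open>R0\<close>, and 0 within \<open>R0\<close>.\<close>
      have ge: "2 * (?i (\<rho> k) x - ?i (\<rho> (Suc k)) x) - ?i R0 x \<le> Re (g x * inv_fourier (F k) x)" for x
      proof -
        have "\<bar>Re (g x * inv_fourier (F k) x)\<bar> \<le> norm (g x * inv_fourier (F k) x)" by (rule abs_Re_le_cmod)
        also have "\<dots> \<le> h x" using g(2)[of x] by (simp add: h_def norm_mult mult_left_le_one_le)
        finally have abs: "- h x \<le> Re (g x * inv_fourier (F k) x)" by linarith
        consider "real (\<rho> k) < norm x" "norm x \<le> real (\<rho> (Suc k))" | "real (\<rho> (Suc k)) < norm x"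
          | "norm x \<le> real (\<rho> k)" "real R0 < norm x" | "norm x \<le> real R0" by linarith
        then show ?thesis
        proof cases
          case 1
          then show ?thesis using g(4)[OF k 1] \<open>R0 \<le> \<rho> k\<close> by (simp add: h_def indicator_def)
        next
          case 2
          then show ?thesis using abs \<open>R0 \<le> \<rho> k\<close> \<open>\<rho> k < \<rho> (Suc k)\<close> by (simp add: indicator_def)
        next
          case 3
          then show ?thesis using abs \<open>\<rho> k < \<rho> (Suc k)\<close> by (simp add: indicator_def)
        next
          case 4
          then show ?thesis using g(3)[of x] \<open>R0 \<le> \<rho> k\<close> \<open>R0 \<le> \<rho> m\<close> \<open>\<rho> k < \<rho> (Suc k)\<close>
            by (simp add: indicator_def)
        qed
      qed
      have "3 / 8 * \<eta> \<le> 2 * (tail (real (\<rho> k)) (F k) - tail (real (\<rho> (Suc k))) (F k)) - tail (real R0) (F k)"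
        using E(2)[of "\<rho> k"] nx(2)[of "\<rho> k"] R0[OF F(1)[of k]] by (simp add: F_def \<rho>_Suc)
      also have "\<dots> = (LINT x|lebesgue. 2 * (?i (\<rho> k) x - ?i (\<rho> (Suc k)) x) - ?i R0 x)"
        using int by (simp add: tail)
      also have "\<dots> \<le> (LINT x|lebesgue. Re (g x * inv_fourier (F k) x))"
        by (intro integral_mono integrable_Re intg ge Bochner_Integration.integrable_diff
            integrable_mult_right int)
      also have "\<dots> = Re (pairing g (F k))" using F(2) intg by (simp only: pairing_def if_True integral_Re)
      also have "\<dots> \<le> norm (pairing g (F k))" by (rule complex_Re_le_cmod)
      finally show ?thesis .
    qed
    then have "3 / 8 * \<eta> \<le> norm (pairing g H)"
      by (rule norm_free_filter_limit_ge[OF H(2)[OF dual]])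
    also have "\<dots> \<le> tail (real m) H"
    proof (rule pairing_le_tail[OF g(1,2) _ H(1)])
      show "g x = 0" if "norm x \<le> real m" for x
        using g(3)[of x] that strict_mono_imp_increasing[OF \<rho>, of m] by simp
    qed
    finally show ?thesis .
  qed
  then have "3 / 8 * \<eta> \<le> 0"
    using tail_tendsto_0[OF H(1)] by (intro tendsto_lowerbound[of _ 0 sequentially]) auto
  then show False using \<eta> by simp
qed

end

section \<open>Equicontinuity and finite dimension\<close>

lemma norm_exp_diff_le:
  "norm (exp (- (\<i> * complex_of_real a)) - exp (- (\<i> * complex_of_real b))) \<le> \<bar>a - b\<bar>"
proof -
  have "exp (- (\<i> * complex_of_real a)) - exp (- (\<i> * complex_of_real b)) =
      exp (- (\<i> * complex_of_real b)) * (exp (\<i> * complex_of_real (b - a)) - 1)"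
    by (simp add: algebra_simps flip: exp_add)
  then have "norm (exp (- (\<i> * complex_of_real a)) - exp (- (\<i> * complex_of_real b))) =
      2 * \<bar>sin ((b - a) / 2)\<bar>"
    by (simp add: norm_mult dist_exp_i_1 del: of_real_diff)
  also have "\<dots> \<le> \<bar>a - b\<bar>" using abs_sin_x_le_abs_x[of "(b - a) / 2"] by (simp add: abs_minus_commute)
  finally show ?thesis .
qed

context reflexive_fourier_space
begin

text \<open>Within radius \<open>R\<close> the character \<open>exp (- \<i> x \<bullet> \<xi>)\<close> is Lipschitz in \<open>\<xi>\<close> with constant \<open>R\<close>; beyond
  it, two characters differ by at most 2.\<close>

lemma modulus_of_continuity:
  assumes F: "F \<in> Y" and R: "R \<ge> 0"
  shows "norm (F \<xi> - F \<zeta>) \<le> R * norm (\<xi> - \<zeta>) * preimage_norm F + 2 * tail R F"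
proof -
  let ?e = "\<lambda>\<xi> x. exp (- (\<i> * complex_of_real (x \<bullet> \<xi>)))"
  let ?f = "inv_fourier F"
  have int: "integrable lebesgue (\<lambda>x. ?e \<xi> x * ?f x)" for \<xi>
    by (rule integrable_char_mult[OF inv_fourier(1)[OF F]])
  have "F \<xi> - F \<zeta> = (LINT x|lebesgue. ?e \<xi> x * ?f x - ?e \<zeta> x * ?f x)"
    using int inv_fourier(2)[OF F] by (simp add: fourier_R_def fun_eq_iff)
  then have "norm (F \<xi> - F \<zeta>) \<le> (LINT x|lebesgue. norm (?e \<xi> x * ?f x - ?e \<zeta> x * ?f x))"
    by simp
  also have "\<dots> \<le> (LINT x|lebesgue. R * norm (\<xi> - \<zeta>) * norm (?f x) +
      2 * (indicator {x. R < norm x} x * norm (?f x)))"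
  proof (rule integral_mono)
    fix x
    have eq: "norm (?e \<xi> x * ?f x - ?e \<zeta> x * ?f x) = norm (?e \<xi> x - ?e \<zeta> x) * norm (?f x)"
      by (simp add: norm_mult flip: left_diff_distrib)
    have "norm (?e \<xi> x - ?e \<zeta> x) \<le> R * norm (\<xi> - \<zeta>) + 2 * indicator {x. R < norm x} x"
    proof (cases "R < norm x")
      case True
      have "norm (?e \<xi> x - ?e \<zeta> x) \<le> 2"
        using norm_triangle_ineq4[of "?e \<xi> x" "?e \<zeta> x"] by simp
      then show ?thesis using True R by (simp add: add_increasing)
    next
      case False
      have "norm (?e \<xi> x - ?e \<zeta> x) \<le> \<bar>x \<bullet> (\<xi> - \<zeta>)\<bar>"
        using norm_exp_diff_le[of "x \<bullet> \<xi>" "x \<bullet> \<zeta>"] by (simp add: inner_diff_right)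
      also have "\<dots> \<le> norm x * norm (\<xi> - \<zeta>)" by (rule Cauchy_Schwarz_ineq2)
      also have "\<dots> \<le> R * norm (\<xi> - \<zeta>)" using False by (intro mult_right_mono) auto
      finally show ?thesis using False by simp
    qed
    then have "norm (?e \<xi> x - ?e \<zeta> x) * norm (?f x) \<le>
        (R * norm (\<xi> - \<zeta>) + 2 * indicator {x. R < norm x} x) * norm (?f x)"
      by (rule mult_right_mono) simp
    then show "norm (?e \<xi> x * ?f x - ?e \<zeta> x * ?f x) \<le> R * norm (\<xi> - \<zeta>) * norm (?f x) +
        2 * (indicator {x. R < norm x} x * norm (?f x))"
      unfolding eq by (simp add: algebra_simps)
  qed (use int tail_integrable[OF F] inv_fourier(1)[OF F] in auto)
  also have "\<dots> = R * norm (\<xi> - \<zeta>) * preimage_norm F + 2 * tail R F"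
    using tail_integrable[OF F] inv_fourier(1)[OF F] by (simp add: preimage_norm_def tail_def)
  finally show ?thesis .
qed

text \<open>Functions in the unit ball of \<open>Y\<close> vary by at most \<open>2 e\<close> within distance \<open>r\<close>. If \<open>F\<close> vanishes on an \<open>r\<close>-net of
  \<open>K\<close>, then its normalisation \<open>G\<close> is at most \<open>2 e\<close> on \<open>K\<close> and at most \<open>C * (2 * e) \<le> 1 / 2\<close> everywhere,
  which is impossible for a function of norm 1.\<close>

lemma finite_dimensional: "finite_dim Y"
proof -
  obtain K C where K: "compact K" "C \<ge> 0" and
    dom: "\<forall>F\<in>Y. \<forall>M\<ge>0. (\<forall>\<xi>\<in>K. norm (F \<xi>) \<le> M) \<longrightarrow> (\<forall>\<xi>. norm (F \<xi>) \<le> C * M)"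
    using reflexive_controlled_by_compact[OF Y(1-3)] by (elim exE conjE)
  have KC: "norm (F \<xi>) \<le> C * M"
    if "F \<in> Y" "M \<ge> 0" "\<And>\<xi>. \<xi> \<in> K \<Longrightarrow> norm (F \<xi>) \<le> M" for F M \<xi>
    using dom[rule_format, OF that] .
  define e where "e = 1 / (4 * (C + 1))"
  have e: "e > 0" "C * (2 * e) \<le> 1 / 2" using K(2) by (auto simp: e_def field_simps)
  obtain B0 where B0: "\<And>F. F \<in> Y \<Longrightarrow> (\<And>\<xi>. norm (F \<xi>) \<le> 1) \<Longrightarrow> preimage_norm F \<le> B0"
    using inv_fourier_bounded by blast
  obtain R :: nat where R: "\<And>F. F \<in> Y \<Longrightarrow> (\<And>\<xi>. norm (F \<xi>) \<le> 1) \<Longrightarrow> tail (real R) F \<le> e / 2"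
    using tail_uniformly_small[of "e / 2"] e(1) by auto
  define B where "B = max B0 0"
  define r where "r = e / (real R * B + 1)"
  have RB: "real R * B \<ge> 0" by (simp add: B_def)
  have r: "r > 0" using e(1) RB by (simp add: r_def add_nonneg_pos)
  have "real R * r * B = e * ((real R * B) / (real R * B + 1))" by (simp add: r_def)
  also have "\<dots> \<le> e * 1" using e(1) RB by (intro mult_left_mono) (auto simp: divide_le_eq_1)
  finally have rB: "real R * r * B \<le> e" by simp
  have "\<forall>e>0. \<exists>P. finite P \<and> K \<subseteq> (\<Union>p\<in>P. ball p e)"
    using K(1) unfolding compact_eq_totally_bounded by (rule conjunct2)
  with r obtain P where P: "finite P" "K \<subseteq> (\<Union>p\<in>P. ball p r)" by blast
  show ?thesis
  proof (rule finite_dim_of_finite_determining_set[OF P(1) Y(2)])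
    fix F assume F: "F \<in> Y" and zero: "\<And>p. p \<in> P \<Longrightarrow> F p = 0"
    have le: "norm (F \<xi>) \<le> sup_norm F" for \<xi> using F Y(1) by (auto intro: norm_le_sup_norm)
    have "sup_norm F \<le> 0"
    proof (rule ccontr)
      assume "\<not> ?thesis"
      then have s: "sup_norm F > 0" by simp
      define G where "G = cscale (1 / complex_of_real (sup_norm F)) F"
      have nG: "norm (G \<xi>) = norm (F \<xi>) / sup_norm F" for \<xi>
        using s by (simp add: G_def cscale_def norm_mult norm_divide)
      have G: "G \<in> Y" "\<And>\<xi>. norm (G \<xi>) \<le> 1"
        using s le F by (auto simp: nG divide_le_eq_1) (simp add: G_def scale_mem)
      have "norm (G \<xi>) \<le> 2 * e" if "\<xi> \<in> K" for \<xi>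
      proof -
        obtain p where p: "p \<in> P" "dist p \<xi> < r" using P(2) \<open>\<xi> \<in> K\<close> by auto
        have "G p = 0" using zero[OF p(1)] by (simp add: G_def cscale_def)
        then have "norm (G \<xi>) \<le> real R * norm (\<xi> - p) * preimage_norm G + 2 * tail (real R) G"
          using modulus_of_continuity[OF G(1), of "real R" \<xi> p] by simp
        also have "\<dots> \<le> real R * r * B + 2 * (e / 2)"
        proof (rule add_mono)
          have "preimage_norm G \<le> B" using B0[OF G] by (simp add: B_def)
          moreover have "norm (\<xi> - p) \<le> r" using p(2) by (simp add: dist_norm norm_minus_commute)
          moreover have "0 \<le> preimage_norm G" by (simp add: preimage_norm_def)
          ultimately show "real R * norm (\<xi> - p) * preimage_norm G \<le> real R * r * B"
            using r by (intro mult_mono) auto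
        qed (use R[OF G] in simp)
        finally show ?thesis using rB by simp
      qed
      then have "norm (G \<xi>) \<le> C * (2 * e)" for \<xi> using KC[OF G(1), of "2 * e"] e(1) by simp
      then have "norm (F \<xi>) \<le> sup_norm F / 2" for \<xi>
        using e(2) s order_trans[of "norm (G \<xi>)" "C * (2 * e)" "1 / 2"] by (simp add: nG field_simps)
      then have "sup_norm F \<le> sup_norm F / 2" by (rule sup_norm_le)
      then show False using s by simp
    qed
    then have "F \<xi> = 0" for \<xi> using le[of \<xi>] norm_ge_zero[of "F \<xi>"] by (metis norm_le_zero_iff order_trans)
    then show "F = 0" by (simp add: fun_eq_iff)
  qed
qed

end

lemma closed_subspace_C0_D:
  assumes "closed_subspace_C0 Y" shows "Y \<subseteq> C0" "cfun.subspace Y"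
  using assms closedin_subset[of C0.mtopology Y] unfolding closed_subspace_C0_def by auto

theorem theorem4p1:
  shows "(\<forall>Y :: (real ^ 'n \<Rightarrow> complex) set.
            closed_subspace_C0 Y \<and> Y \<subseteq> FL1_R \<and> reflexive Y sup_norm \<longrightarrow> finite_dim Y) \<and>
         (\<forall>Y :: (int ^ 'n \<Rightarrow> complex) set.
            closed_subspace_C0 Y \<and> Y \<subseteq> FL1_T \<and> reflexive Y sup_norm \<longrightarrow> finite_dim Y)"
proof (intro conjI allI impI)
  fix Y :: "(real ^ 'n \<Rightarrow> complex) set"
  assume "closed_subspace_C0 Y \<and> Y \<subseteq> FL1_R \<and> reflexive Y sup_norm"
  then show "finite_dim Y"
    by (intro reflexive_fourier_space.finite_dimensional) (simp add: closed_subspace_C0_D reflexive_fourier_space_def)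
next
  fix Y :: "(int ^ 'n \<Rightarrow> complex) set"
  assume "closed_subspace_C0 Y \<and> Y \<subseteq> FL1_T \<and> reflexive Y sup_norm"
  then show "finite_dim Y"
    by (intro reflexive_finite_dim_discrete) (simp_all add: closed_subspace_C0_D)
qed

end
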